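(* Let $\Gamma$ be a compact metric graph with $E$ edges, and let $U$ and $\mathcal{H}_{\mathcal{A},\xi}$ be as defined in the context. (1) The set $\mathcal{S}$ of all $(\mathcal{A},\xi,\lambda)\in U\times(\mathbb{C}\setminus\{0\})^E\times\mathbb{C}$ such that $\mathcal{H}_{\mathcal{A},\xi}-\lambda\mathbb{I}$ does not have a bounded inverse in $L^2(\Gamma)$ is principal analytic. Namely, there exists a non-zero function $\Phi(\mathcal{A},\xi,\lambda)$, analytic in $U\times(\mathbb{C}\setminus\{0\})^E\times\mathbb{C}$, such that $\mathcal{S}$ coincides with the set of its zeros. (2) For any integer $k\ge1$, the set $\mathcal{S}_k$ of all $(\mathcal{A},\xi,\lambda)\in U\times(\mathbb{C}\setminus\{0\})^E\times\mathbb{C}$ such that $\dim\ker\left(\mathcal{H}_{\mathcal{A},\xi}-\lambda\mathbb{I}\right)\ge k$ is analytic.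
   Context: A compact metric graph $\Gamma$ has a finite vertex set $\mathcal{V}$ and a finite edge set $\mathcal{E}$; each edge $e$ is a segment of finite length $L_e>0$ with a coordinate $x_e$. $E$ is the number of edges. $L^2(\Gamma)=\bigoplus_{e}L^2(e)$ and $\widetilde{H}^2(\Gamma)=\bigoplus_{e\in\mathcal{E}}H^2(e)$ (no conditions at vertices). For a vertex $v$ of degree $d_v$ and $f\in\widetilde{H}^2(\Gamma)$, $F(v)\in\mathbb{C}^{d_v}$ is the column vector of values of $f$ at $v$ along the $d_v$ edge-ends incident to $v$, and $F'(v)\in\mathbb{C}^{d_v}$ is the column vector of the derivatives of $f$ at $v$ along these edges, taken away from the vertex and into the edges. Put $q=\sum_{v}d_v^2$. A collection $\mathcal{A}=\{(A_v\ B_v)\}_{v\in\mathcal{V}}$ of complex $d_v\times 2d_v$ matrices is identified with a point of $\mathbb{C}^{2q}$. $U\subset\mathbb{C}^{2q}$ is the (open) set of all $\mathcal{A}$ such that $(A_v\ B_v)$ has maximal rank $d_v$ for every $v\in\mathcal{V}$. For $\xi=\{\xi_e\}_{e\in\mathcal{E}}\in(\mathbb{C}\setminus\{0\})^E$, let $\Xi_v$ be the diagonal $d_v\times d_v$ matrix whose diagonal entries are the $\xi_e$ for the edges $e$ incident to $v$ (in the same order as in $F(v)$). $\mathcal{H}_{\mathcal{A},\xi}$ is the unbounded operator in $L^2(\Gamma)$ acting as $-\xi_e^{-2}\,d^2/dx_e^2$ on each edge $e$, with domain $\{f\in\widetilde{H}^2(\Gamma)\mid A_vF(v)+B_v\Xi_vF'(v)=0\text{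 for all }v\in\mathcal{V}\}$. $\mathbb{I}$ is the identity operator in $L^2(\Gamma)$. A subset of a complex manifold is analytic if it is closed and locally the common zero set of finitely many analytic functions. *)

theory Defs
  imports "HOL-Analysis.Analysis" "HOL-Library.Function_Algebras"
begin

section \<open>Compact metric graphs\<close>

text \<open>
  Vertices and edges are the elements of finite types. The edge \<open>e\<close> is the segment
  \<open>{0..edge_length G e}\<close>. Its two edge-ends are \<open>(e, False)\<close>, sitting at coordinate \<open>0\<close>, and
  \<open>(e, True)\<close>, sitting at coordinate \<open>edge_length G e\<close>; \<open>end_vertex\<close> says to which vertex an
  edge-end is attached. Loops and multiple edges are allowed; a loop contributes two edge-ends
  (hence two units of degree) to its vertex.
\<close>

type_synonym 'e edge_end = "'e \<times> bool"

record ('v, 'e) metric_graph =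
  end_vertex :: "'e edge_end \<Rightarrow> 'v"
  edge_length :: "'e \<Rightarrow> real"

definition ends_at :: "('v, 'e::finite) metric_graph \<Rightarrow> 'v \<Rightarrow> 'e edge_end set" where
  "ends_at G v = {h. end_vertex G h = v}"

definition degree :: "('v, 'e::finite) metric_graph \<Rightarrow> 'v \<Rightarrow> nat" where
  "degree G v = card (ends_at G v)"


section \<open>The Hilbert space $L^2(\Gamma)$ and the Sobolev space $\widetilde H^2(\Gamma)$\<close>

text \<open>
  Elements of $L^2$ are represented by functions, to be compared with almost-everywhere equality
  on the edges (\<open>L2_eq\<close>).
\<close>

definition L2_interval :: "real \<Rightarrow> (real \<Rightarrow> complex) set" where
  "L2_interval l = {f. f \<in> borel_measurable (lebesgue_on {0..l}) \<and>
                       integrable (lebesgue_on {0..l}) (\<lambda>x. (norm (f x))\<^sup>2)}"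

text \<open>
  Weak derivatives on the open interval $(0,l)$, tested against compactly supported $C^1$
  functions.
\<close>

definition is_weak_deriv :: "real \<Rightarrow> (real \<Rightarrow> complex) \<Rightarrow> (real \<Rightarrow> complex) \<Rightarrow> bool" where
  "is_weak_deriv l f g \<longleftrightarrow>
     (\<forall>\<phi>::real \<Rightarrow> real. \<phi> C1_differentiable_on UNIV \<and> closure {x. \<phi> x \<noteq> 0} \<subseteq> {0<..<l} \<longrightarrow>
        (LINT x|lebesgue_on {0..l}. vector_derivative \<phi> (at x) *\<^sub>R f x) =
        - (LINT x|lebesgue_on {0..l}. \<phi> x *\<^sub>R g x))"

definition H2_interval :: "real \<Rightarrow> (real \<Rightarrow> complex) set" where
  "H2_interval l = {f \<in> L2_interval l. \<exists>f1 \<in> L2_interval l. \<exists>f2 \<in> L2_interval l.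
                      is_weak_deriv l f f1 \<and> is_weak_deriv l f1 f2}"

text \<open>Only determined up to almost-everywhere equality on \<open>{0..l}\<close>.\<close>

definition weak_deriv :: "real \<Rightarrow> (real \<Rightarrow> complex) \<Rightarrow> (real \<Rightarrow> complex)" where
  "weak_deriv l f = (SOME g. g \<in> L2_interval l \<and> is_weak_deriv l f g)"

definition L2 :: "('v, 'e) metric_graph \<Rightarrow> ('e \<Rightarrow> real \<Rightarrow> complex) set" where
  "L2 G = {f. \<forall>e. f e \<in> L2_interval (edge_length G e)}"

definition L2_eq :: "('v, 'e) metric_graph \<Rightarrow>
    ('e \<Rightarrow> real \<Rightarrow> complex) \<Rightarrow> ('e \<Rightarrow> real \<Rightarrow> complex) \<Rightarrow> bool" where
  "L2_eq G f g \<longleftrightarrow> (\<forall>e. AE x in lebesgue_on {0..edge_length G e}. f e x = g e x)"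

definition L2_norm :: "('v, 'e::finite) metric_graph \<Rightarrow> ('e \<Rightarrow> real \<Rightarrow> complex) \<Rightarrow> real" where
  "L2_norm G f = sqrt (\<Sum>e\<in>UNIV. LINT x|lebesgue_on {0..edge_length G e}. (norm (f e x))\<^sup>2)"

text \<open>
  Every class in $H^2(0,l)$ has exactly one representative that is continuous on \<open>{0..l}\<close> and
  (by convention) \<open>0\<close> elsewhere; it is automatically $C^1$ on \<open>{0..l}\<close>. The elements of
  $\widetilde H^2(\Gamma)$ are identified with these representatives, so that they have vertex
  values and derivatives, and so that equality of functions in \<open>H2_graph G\<close> is equality in
  $L^2(\Gamma)$.
\<close>

definition H2_graph :: "('v, 'e) metric_graph \<Rightarrow> ('e \<Rightarrow> real \<Rightarrow> complex) set" where
  "H2_graph G = {f. \<forall>e. f e \<in> H2_interval (edge_length G e) \<and>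
                        continuous_on {0..edge_length G e} (f e) \<and>
                        (\<forall>x. x \<notin> {0..edge_length G e} \<longrightarrow> f e x = 0)}"

text \<open>Derivatives at an edge-end are taken from the vertex into the edge.\<close>

fun end_value :: "('v, 'e) metric_graph \<Rightarrow> ('e \<Rightarrow> real \<Rightarrow> complex) \<Rightarrow> 'e edge_end \<Rightarrow> complex" where
  "end_value G f (e, False) = f e 0"
| "end_value G f (e, True) = f e (edge_length G e)"

fun end_deriv :: "('v, 'e) metric_graph \<Rightarrow> ('e \<Rightarrow> real \<Rightarrow> complex) \<Rightarrow> 'e edge_end \<Rightarrow> complex" where
  "end_deriv G f (e, False) =
     vector_derivative (f e) (at 0 within {0..edge_length G e})"
| "end_deriv G f (e, True) =
     - vector_derivative (f e) (at (edge_length G e) within {0..edge_length G e})"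


section \<open>The operators $\mathcal H_{\mathcal A,\xi}$\<close>

text \<open>
  Vectors in $\mathbb C^{d_v}$ and matrices of size $d_v \times d_v$ have their entries indexed by
  the edge-ends at \<open>v\<close>. They are stored as vectors and matrices indexed by all edge-ends whose
  entries at other positions are \<open>0\<close>; this padding changes neither products nor ranks.
\<close>

type_synonym 'e end_vec = "complex ^ ('e edge_end)"
type_synonym 'e end_mat = "complex ^ ('e edge_end) ^ ('e edge_end)"

definition vertex_values :: "('v, 'e::finite) metric_graph \<Rightarrow> ('e \<Rightarrow> real \<Rightarrow> complex) \<Rightarrow> 'v \<Rightarrow> 'e end_vec"
  where "vertex_values G f v = (\<chi> h. if h \<in> ends_at G v then end_value G f h else 0)"

definition vertex_derivs :: "('v, 'e::finite) metric_graph \<Rightarrow> ('e \<Rightarrow> real \<Rightarrow> complex) \<Rightarrow> 'v \<Rightarrow> 'e end_vec"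
  where "vertex_derivs G f v = (\<chi> h. if h \<in> ends_at G v then end_deriv G f h else 0)"

definition Xi :: "('v, 'e::finite) metric_graph \<Rightarrow> complex ^ 'e \<Rightarrow> 'v \<Rightarrow> 'e end_mat" where
  "Xi G \<xi> v = (\<chi> h h'. if h = h' \<and> h \<in> ends_at G v then \<xi> $ fst h else 0)"

definition joined :: "'e::finite end_mat \<Rightarrow> 'e end_mat \<Rightarrow>
    complex ^ ('e edge_end + 'e edge_end) ^ ('e edge_end)" where
  "joined M N = (\<chi> h c. case c of Inl h' \<Rightarrow> M $ h $ h' | Inr h' \<Rightarrow> N $ h $ h')"

definition H_dom :: "('v::finite, 'e::finite) metric_graph \<Rightarrow>
    'e end_mat ^ 'v \<Rightarrow> 'e end_mat ^ 'v \<Rightarrow> complex ^ 'e \<Rightarrow> ('e \<Rightarrow> real \<Rightarrow> complex) set" where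
  "H_dom G A B \<xi> = {f \<in> H2_graph G. \<forall>v.
     A $ v *v vertex_values G f v + B $ v *v (Xi G \<xi> v *v vertex_derivs G f v) = 0}"

definition H_op :: "('v, 'e::finite) metric_graph \<Rightarrow> complex ^ 'e \<Rightarrow>
    ('e \<Rightarrow> real \<Rightarrow> complex) \<Rightarrow> ('e \<Rightarrow> real \<Rightarrow> complex)" where
  "H_op G \<xi> f = (\<lambda>e x. - (1 / (\<xi> $ e)\<^sup>2) *
     weak_deriv (edge_length G e) (weak_deriv (edge_length G e) (f e)) x)"

definition H_minus :: "('v, 'e::finite) metric_graph \<Rightarrow> complex ^ 'e \<Rightarrow> complex \<Rightarrow>
    ('e \<Rightarrow> real \<Rightarrow> complex) \<Rightarrow> ('e \<Rightarrow> real \<Rightarrow> complex)" where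
  "H_minus G \<xi> z f = (\<lambda>e x. H_op G \<xi> f e x - z * f e x)"

text \<open>
  An operator \<open>T\<close> in $L^2(\Gamma)$ with domain \<open>D \<subseteq> H2_graph G\<close> has a bounded inverse \<open>R\<close>, defined
  on all of $L^2(\Gamma)$. The last conjunct says both that \<open>R (T f) = f\<close> on \<open>D\<close> and that \<open>R\<close> is
  well defined on almost-everywhere classes. Linearity of \<open>R\<close> follows from that of \<open>T\<close>.
\<close>

definition has_bounded_inverse :: "('v, 'e::finite) metric_graph \<Rightarrow> ('e \<Rightarrow> real \<Rightarrow> complex) set \<Rightarrow>
    (('e \<Rightarrow> real \<Rightarrow> complex) \<Rightarrow> ('e \<Rightarrow> real \<Rightarrow> complex)) \<Rightarrow> bool" where
  "has_bounded_inverse G D T \<longleftrightarrow> (\<exists>R C. \<forall>g \<in> L2 G.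
     R g \<in> D \<and> L2_eq G (T (R g)) g \<and> L2_norm G (R g) \<le> C * L2_norm G g \<and>
     (\<forall>f \<in> D. L2_eq G (T f) g \<longrightarrow> R g = f))"

definition H_kernel :: "('v::finite, 'e::finite) metric_graph \<Rightarrow>
    'e end_mat ^ 'v \<Rightarrow> 'e end_mat ^ 'v \<Rightarrow> complex ^ 'e \<Rightarrow> complex \<Rightarrow>
    ('e \<Rightarrow> real \<Rightarrow> complex) set" where
  "H_kernel G A B \<xi> z = {f \<in> H_dom G A B \<xi>. L2_eq G (H_minus G \<xi> z f) (\<lambda>_ _. 0)}"

interpretation edge_fun: vector_space "\<lambda>(c::complex) (f::'e \<Rightarrow> real \<Rightarrow> complex). (\<lambda>e x. c * f e x)"
  by unfold_locales (auto simp: fun_eq_iff algebra_simps)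


section \<open>The parameter manifold and analytic sets\<close>

text \<open>
  A parameter is a tuple \<open>(A, B, \<xi>, z)\<close>, with \<open>z\<close> the spectral parameter. Because of the padding, the parameter space
  $\mathbb C^{2q} \times \mathbb C^E \times \mathbb C$ is the complex linear subspace
  \<open>param_space G\<close> of the type below.
\<close>

type_synonym ('v, 'e) param =
  "('e end_mat ^ 'v) \<times> ('e end_mat ^ 'v) \<times> (complex ^ 'e) \<times> complex"

definition supported :: "('v::finite, 'e::finite) metric_graph \<Rightarrow> 'e end_mat ^ 'v \<Rightarrow> bool" where
  "supported G A \<longleftrightarrow>
     (\<forall>v h h'. \<not> (h \<in> ends_at G v \<and> h' \<in> ends_at G v) \<longrightarrow> A $ v $ h $ h' = 0)"

definition param_space :: "('v::finite, 'e::finite) metric_graph \<Rightarrow> ('v, 'e) param set" where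
  "param_space G = {(A, B, \<xi>, z). supported G A \<and> supported G B}"

definition max_rank :: "('v::finite, 'e::finite) metric_graph \<Rightarrow>
    ('e end_mat ^ 'v) \<Rightarrow> ('e end_mat ^ 'v) \<Rightarrow> bool" where
  "max_rank G A B \<longleftrightarrow> (\<forall>v. rank (joined (A $ v) (B $ v)) = degree G v)"

text \<open>$U \times (\mathbb C \setminus \{0\})^E \times \mathbb C$, an open subset of \<open>param_space G\<close>.\<close>

definition param_manifold :: "('v::finite, 'e::finite) metric_graph \<Rightarrow> ('v, 'e) param set" where
  "param_manifold G =
     {(A, B, \<xi>, z) \<in> param_space G. max_rank G A B \<and> (\<forall>e. \<xi> $ e \<noteq> 0)}"

fun param_scale :: "complex \<Rightarrow> ('v::finite, 'e::finite) param \<Rightarrow> ('v, 'e) param" where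
  "param_scale c (A, B, \<xi>, z) =
     ((\<chi> v h h'. c * A $ v $ h $ h'), (\<chi> v h h'. c * B $ v $ h $ h'), c *s \<xi>, c * z)"

text \<open>
  Analyticity of functions of several complex variables as complex differentiability at every
  point, in line with the one-variable library notion \<open>analytic_on\<close>. It is used on sets \<open>M\<close> that
  are open in the complex subspace \<open>param_space G\<close>, so derivatives are taken within \<open>M\<close>.
\<close>

definition analytic_fun :: "('v::finite, 'e::finite) param set \<Rightarrow>
    (('v, 'e) param \<Rightarrow> complex) \<Rightarrow> bool" where
  "analytic_fun M f \<longleftrightarrow> (\<forall>p \<in> M. \<exists>D. (f has_derivative D) (at p within M) \<and>
     (\<forall>c h. D (param_scale c h) = c * D h))"

definition analytic_subset :: "('v::finite, 'e::finite) param set \<Rightarrow> ('v, 'e) param set \<Rightarrow> bool" where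
  "analytic_subset M S \<longleftrightarrow> closedin (top_of_set M) S \<and>
     (\<forall>p \<in> M. \<exists>N F. openin (top_of_set M) N \<and> p \<in> N \<and> finite F \<and> (\<forall>f \<in> F. analytic_fun N f) \<and>
        S \<inter> N = {x \<in> N. \<forall>f \<in> F. f x = 0})"

definition spectral_set :: "('v::finite, 'e::finite) metric_graph \<Rightarrow> ('v, 'e) param set" where
  "spectral_set G = {(A, B, \<xi>, z) \<in> param_manifold G.
     \<not> has_bounded_inverse G (H_dom G A B \<xi>) (H_minus G \<xi> z)}"

text \<open>
  The kernel is finite-dimensional (solutions of a linear second-order equation on each of the
  finitely many edges), so the value of \<open>dim\<close> at infinite-dimensional spaces plays no role.
\<close>

definition spectral_set_mult :: "('v::finite, 'e::finite) metric_graph \<Rightarrow> nat \<Rightarrow> ('v, 'e) param set" where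
  "spectral_set_mult G k = {(A, B, \<xi>, z) \<in> param_manifold G.
     k \<le> edge_fun.dim (H_kernel G A B \<xi> z)}"

end

theory Submission
  imports Defs
begin

text \<open>
  On an edge, \<open>-\<xi>\<^sup>-\<^sup>2 f'' - z f = g\<close> becomes \<open>f'' = w f - \<xi>\<^sup>2 g\<close> with \<open>w = - z \<xi>\<^sup>2\<close>. By the
  du Bois-Reymond lemma, weak solutions are \<open>C1\<close> functions solving the equation in integrated form,
  and those with \<open>g = 0\<close> are the combinations of two fundamental solutions that are entire in \<open>w\<close>.
  The vertex conditions are then a square linear system, indexed by the edge-ends, for the Cauchy data;
  its matrix depends analytically on the parameters. The kernel of the operator is isomorphic to the
  kernel of this matrix. Invertibility of the matrix also gives solvability for every \<open>g\<close>, with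
  bounds, by correcting a particular solution by a homogeneous one. So the spectral set is the zero
  set of the determinant, and the kernel has dimension at least \<open>k\<close> exactly where certain minors vanish.
\<close>

section \<open>Primitives and weak derivatives\<close>

text \<open>The degrees of the vertices add up to twice the number of edges, so there are as many
  scalar vertex conditions as Cauchy data, two per edge; this makes the system square and lets a
  single determinant describe (1). The analytic obstacle is that \<open>H_op\<close> is built from
  weak derivatives picked by choice and determined only almost everywhere, while vertex conditions
  need pointwise values. The integrated form removes it: f' is a constant plus a primitive, which
  makes sense for a right-hand side that is merely square integrable and leaves f and f' continuous.
  Bounded invertibility could a priori fail through non-uniqueness, non-surjectivity or
  unboundedness; the reduction ties all three to the same matrix, and a singular matrix already
  destroys uniqueness. Normalising the fundamental solutions at coordinate 0 keeps them independent
  at w = 0, where exponentials would coincide, and even in the square root of w. For (2), minors of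
  varying size are represented by determinants of full size with replaced columns, so that one
  analyticity lemma serves all of them.\<close>

lemma sigma_finite_lebesgue_on_interval: "sigma_finite_measure (lebesgue_on {a..b::real})"
  by (simp add: finite_measure_lebesgue_on finite_measure.axioms(1))

lemma L2_interval_integrable:
  assumes "f \<in> L2_interval l"
  shows "integrable (lebesgue_on {0..l}) f"
proof (rule Bochner_Integration.integrable_bound)
  show "integrable (lebesgue_on {0..l}) (\<lambda>x. 1 + (norm (f x))\<^sup>2)"
    using assms by (auto simp: L2_interval_def)
  show "f \<in> borel_measurable (lebesgue_on {0..l})"
    using assms by (auto simp: L2_interval_def)
  have "norm (f x) \<le> norm (1 + (norm (f x))\<^sup>2)" for x
  proof -
    have "2 * norm (f x) \<le> 1 + (norm (f x))\<^sup>2"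
      using zero_le_power2[of "norm (f x) - 1"] by (simp add: power2_eq_square algebra_simps)
    then show ?thesis
      using norm_ge_zero[of "f x"] by (smt (verit) norm_of_real real_norm_def)
  qed
  then show "AE x in lebesgue_on {0..l}. norm (f x) \<le> norm (1 + (norm (f x))\<^sup>2)"
    by simp
qed

lemma integrable_on_prefix:
  fixes h :: "real \<Rightarrow> complex"
  assumes "integrable (lebesgue_on {0..l}) h" "x \<le> l"
  shows "h integrable_on {0..x}"
  using integrable_on_lebesgue_on[OF assms(1)] assms(2)
  by (auto intro: integrable_on_subinterval)

text \<open>Moving the upper limit into a cut-off factor gives an integral over a fixed measure
  space, where Fubini and dominated convergence apply. It also links the Henstock-Kurzweil integral
  with the Lebesgue one.\<close>

lemma integral_prefix_eq_LINT:
  fixes h :: "real \<Rightarrow> complex"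
  assumes "integrable (lebesgue_on {0..l}) h" "x \<in> {0..l}"
  shows "integral {0..x} h = (LINT t|lebesgue_on {0..l}. (if t \<le> x then 1 else 0) *\<^sub>R h t)"
proof -
  have int: "integrable (lebesgue_on {0..x}) h"
    using assms set_integrable_subset[of lebesgue "{0..l}" h "{0..x}"]
    by (auto simp: set_integrable_def integrable_restrict_space)
  then show ?thesis
    using assms(2) by (auto simp: lebesgue_integral_eq_integral[OF int, symmetric]
        Lebesgue_Measure.integral_restrict_UNIV[symmetric] intro!: Bochner_Integration.integral_cong)
qed

text \<open>Integration by parts for a merely integrable \<open>h\<close>, where no pointwise
  derivative of \<open>F\<close> is available: Fubini on the triangle t \<le> x replaces it.\<close>

lemma is_weak_deriv_primitive:
  assumes h: "integrable (lebesgue_on {0..l}) h" and l: "0 \<le> l"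
    and F: "\<And>x. x \<in> {0..l} \<Longrightarrow> F x = c + integral {0..x} h"
  shows "is_weak_deriv l F h"
  unfolding is_weak_deriv_def
proof (intro allI impI, elim conjE)
  fix \<phi> :: "real \<Rightarrow> real"
  assume C1: "\<phi> C1_differentiable_on UNIV" and supp: "closure {x. \<phi> x \<noteq> 0} \<subseteq> {0<..<l}"
  let ?M = "lebesgue_on {0..l}"
  define d where "d = (\<lambda>x. vector_derivative \<phi> (at x))"
  have d: "(\<phi> has_vector_derivative d x) (at x)" for x
    using C1 by (auto simp: C1_differentiable_on_eq d_def vector_derivative_works[symmetric])
  have dc: "continuous_on UNIV d"
    using C1 by (auto simp: C1_differentiable_on_eq d_def)
  have dm: "d \<in> borel_measurable borel"
    using dc by (rule borel_measurable_continuous_onI)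
  have [measurable]: "d \<in> borel_measurable ?M"
    by (rule measurable_restrict_space1) (use dm in \<open>auto intro: measurable_completion\<close>)
  have [measurable]: "h \<in> borel_measurable ?M" using h by auto
  have id[measurable]: "(\<lambda>x. x) \<in> borel_measurable ?M"
    by (rule measurable_restrict_space1) (auto intro: measurable_completion)
  \<comment> \<open>The support lies in the open interval, so the boundary terms at both ends
    vanish.\<close>
  have z: "\<phi> x = 0" if "x \<le> 0 \<or> l \<le> x" for x
  proof (rule ccontr)
    assume "\<phi> x \<noteq> 0"
    then have "x \<in> closure {x. \<phi> x \<noteq> 0}" by (intro subsetD[OF closure_subset]) auto
    then show False using supp that by auto
  qed
  interpret sigma_finite_measure ?M by (rule sigma_finite_lebesgue_on_interval)
  interpret P: pair_sigma_finite ?M ?M ..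
  have dint: "integrable ?M d"
    using continuous_imp_integrable_real continuous_on_subset[OF dc] by blast
  let ?k = "\<lambda>x t. (d x * (if t \<le> x then 1 else 0)) *\<^sub>R h t"
  have kint: "integrable ?M (?k x)" for x
    using integrable_mult_indicator[of "{t \<in> space ?M. t \<le> x}" ?M "\<lambda>t. d x *\<^sub>R h t"] h
    by (rule_tac Bochner_Integration.integrable_bound[of ?M "\<lambda>t. d x *\<^sub>R h t"]) (auto)
  have "integrable (?M \<Otimes>\<^sub>M ?M) (\<lambda>(x, t). ?k x t)"
  proof (rule P.Fubini_integrable)
    show "(\<lambda>(x, t). ?k x t) \<in> borel_measurable (?M \<Otimes>\<^sub>M ?M)"
      by measurable
    show "AE x in ?M. integrable ?M (\<lambda>y. case (x, y) of (x, t) \<Rightarrow> ?k x t)"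
      using kint by simp
    show "integrable ?M (\<lambda>x. LINT y|?M. norm (case (x, y) of (x, t) \<Rightarrow> ?k x t))"
    proof (rule Bochner_Integration.integrable_bound)
      show "integrable ?M (\<lambda>x. norm (d x) * (LINT t|?M. norm (h t)))"
        using dint by auto
      have "(LINT y|?M. norm (?k x y)) \<le> (LINT t|?M. norm (d x) * norm (h t))" for x
        using integrable_norm[OF kint[of x]] h by (intro integral_mono) (auto simp: mult_right_mono)
      then have "\<bar>LINT y|?M. norm (?k x y)\<bar> \<le> norm (d x) * (LINT t|?M. norm (h t))" for x
        by (subst abs_of_nonneg) auto
      then show "AE x in ?M. norm (LINT y|?M. norm (case (x, y) of (x, t) \<Rightarrow> ?k x t)) \<le> norm (norm (d x) * (LINT t|?M. norm (h t)))"
        by (auto simp: abs_mult)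
      show "(\<lambda>x. LINT y|?M. norm (case (x, y) of (x, t) \<Rightarrow> ?k x t)) \<in> borel_measurable ?M"
        by measurable
    qed
  qed
  then have swap: "(LINT t|?M. LINT x|?M. ?k x t) = (LINT x|?M. LINT t|?M. ?k x t)"
    by (rule P.Fubini_integral)
  have ftc: "(d has_integral \<phi> b - \<phi> a) {a..b}" if "a \<le> b" for a b
    using that d by (intro fundamental_theorem_of_calculus) (auto intro: has_vector_derivative_at_within)
  have "(LINT x|?M. LINT t|?M. ?k x t) = (LINT x|?M. d x *\<^sub>R integral {0..x} h)"
    by (intro Bochner_Integration.integral_cong)
       (auto simp: integral_prefix_eq_LINT[OF h] simp flip: scaleR_scaleR integral_scaleR_right)
  also have "\<dots> = (LINT x|?M. d x *\<^sub>R (F x - c))"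
    using F by (intro Bochner_Integration.integral_cong) auto
  \<comment> \<open>The constant \<open>c\<close> drops out because the derivative of a test
    function has integral zero.\<close>
  also have "\<dots> = (LINT x|?M. d x *\<^sub>R F x)"
  proof -
    have c1: "continuous_on {0..l} (\<lambda>x. c + integral {0..x} h)"
      using h integrable_on_prefix[OF h] by (intro continuous_intros indefinite_integral_continuous_1) auto
    have cF: "continuous_on {0..l} F"
      using c1 by (rule continuous_on_eq) (use F in auto)
    have "integrable ?M (\<lambda>x. d x *\<^sub>R F x)"
      using cF dc by (intro continuous_imp_integrable_real continuous_intros) (auto intro: continuous_on_subset)
    moreover have "integrable ?M (\<lambda>x. d x *\<^sub>R c)"
      using dint by auto
    moreover have "(LINT x|?M. d x *\<^sub>R c) = 0"
    proof -
      have "(LINT x|?M. d x) = integral {0..l} d"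
        using dint by (intro lebesgue_integral_eq_integral) auto
      also have "\<dots> = 0" using ftc[OF l] z[of 0] z[of l] by (simp add: integral_unique)
      finally show ?thesis using dint by simp
    qed
    ultimately show ?thesis by (simp add: scaleR_diff_right)
  qed
  finally have 1: "(LINT x|?M. LINT t|?M. ?k x t) = (LINT x|?M. d x *\<^sub>R F x)" .
  \<comment> \<open>Integrating in x first leaves the derivative of \<open>\<phi>\<close> over
    \<open>{t..l}\<close>, hence the minus sign of the weak derivative.\<close>
  have inner: "(LINT x|?M. ?k x t) = - (\<phi> t *\<^sub>R h t)" if "t \<in> {0..l}" for t
  proof -
    have "(LINT x|?M. d x * (if t \<le> x then 1 else 0)) = (LINT x|lebesgue. (if x \<in> {t..l} then d x else 0))"
      by (subst Lebesgue_Measure.integral_restrict_UNIV[symmetric])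
         (use that in \<open>auto intro!: Bochner_Integration.integral_cong\<close>)
    also have "\<dots> = (LINT x|lebesgue_on {t..l}. d x)"
      by (subst Lebesgue_Measure.integral_restrict_UNIV) auto
    also have "\<dots> = integral {t..l} d"
      using continuous_on_subset[OF dc] by (intro lebesgue_integral_eq_integral continuous_imp_integrable_real) auto
    also have "\<dots> = - \<phi> t" using ftc[of t l] that z[of l] by (simp add: integral_unique)
    finally have e: "(LINT x|?M. d x * (if t \<le> x then 1 else 0)) = - \<phi> t" .
    have "integrable ?M (\<lambda>x. d x * (if t \<le> x then 1 else 0))"
      by (rule Bochner_Integration.integrable_bound[OF dint]) auto
    then show ?thesis using e by simp
  qed
  have "(LINT t|?M. LINT x|?M. ?k x t) = (LINT t|?M. - (\<phi> t *\<^sub>R h t))"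
    using inner by (intro Bochner_Integration.integral_cong) auto
  also have "\<dots> = - (LINT x|?M. \<phi> x *\<^sub>R h x)" by simp
  finally show "(LINT x|?M. vector_derivative \<phi> (at x) *\<^sub>R F x) = - (LINT x|?M. \<phi> x *\<^sub>R h x)"
    using 1 swap by (simp add: d_def)
qed

text \<open>An integrable function is zero almost everywhere once its integrals over all measurable
  sets vanish. The hypothesis gives this for initial segments, and a Dynkin system argument extends
  it.\<close>

lemma primitive_zero_imp_AE_zero:
  fixes h :: "real \<Rightarrow> complex"
  assumes h: "integrable (lebesgue_on {0..l}) h"
    and z: "\<And>x. x \<in> {0..l} \<Longrightarrow> integral {0..x} h = 0" and l: "0 \<le> l"
  shows "AE x in lebesgue_on {0..l}. h x = 0"
proof (rule sigma_finite_measure.density_zero[OF sigma_finite_lebesgue_on_interval h])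
  let ?M = "lebesgue_on {0..l}"
  define P where "P = (\<lambda>A. set_lebesgue_integral ?M (A \<inter> {0..l}) h = 0)"
  have setI: "A \<inter> {0..l} \<in> sets ?M" if "A \<in> sets lebesgue" for A
    using that by (auto simp: sets_restrict_space)
  have si: "set_integrable ?M A h" if "A \<in> sets ?M" for A
    using h that unfolding set_integrable_def by (intro integrable_mult_indicator)
  have full: "set_lebesgue_integral ?M ({..a} \<inter> {0..l}) h = 0" for a
  proof -
    let ?b = "min a l"
    show ?thesis
    proof (cases "0 \<le> a")
      case True
      have "set_lebesgue_integral ?M ({..a} \<inter> {0..l}) h = (LINT t|?M. (if t \<le> ?b then 1 else 0) *\<^sub>R h t)"
        unfolding set_lebesgue_integral_def by (intro Bochner_Integration.integral_cong) auto
      also have "\<dots> = 0"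
        using z[of ?b] integral_prefix_eq_LINT[OF h, of ?b] True l by simp
      finally show ?thesis .
    next
      case False
      then have "{..a} \<inter> {0..l} = {}" by auto
      then show ?thesis by (simp add: set_lebesgue_integral_def)
    qed
  qed
  \<comment> \<open>The sets \<open>{..a}\<close> are stable under intersection and generate the
    Borel sets, and \<open>P\<close> is preserved by complements and disjoint countable
    unions.\<close>
  have borelP: "P A" if "A \<in> sigma_sets UNIV (range (\<lambda>a. {..a::real}))" for A
  proof -
    have IS: "Int_stable (range (\<lambda>a. {..a::real}))" by (auto simp: Int_stable_def)
    have "range (\<lambda>a. {..a::real}) \<subseteq> Pow UNIV" by auto
    from IS this that show ?thesis
    proof (induction rule: sigma_sets_induct_disjoint)
      case (basic A)
      then show ?case using full by (auto simp: P_def)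
    next
      case empty
      show ?case by (simp add: P_def set_lebesgue_integral_def)
    next
      case (compl A)
      then have A: "A \<in> sets borel" by (simp add: borel_eq_atMost)
      have tot: "set_lebesgue_integral ?M {0..l} h = 0"
        using full[of l] by (simp add: Int_absorb1 )
      have 1: "{0..l} = (A \<inter> {0..l}) \<union> ((UNIV - A) \<inter> {0..l})" by auto
      have s1: "A \<inter> {0..l} \<in> sets ?M" "(UNIV - A) \<inter> {0..l} \<in> sets ?M"
        using A by (auto intro!: setI)
      have "set_lebesgue_integral ?M {0..l} h = set_lebesgue_integral ?M (A \<inter> {0..l}) h + set_lebesgue_integral ?M ((UNIV - A) \<inter> {0..l}) h"
        by (subst 1, rule set_integral_Un) (use s1 si in auto)
      then show ?case using compl tot by (simp add: P_def)
    next
      case (union A)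
      then have A: "A i \<in> sets borel" for i by (auto simp: borel_eq_atMost)
      have s1: "A i \<inter> {0..l} \<in> sets ?M" for i
        using A by (auto intro!: setI)
      have "(LINT x:(\<Union>i. A i \<inter> {0..l})|?M. h x) = (\<Sum>i. (LINT x:(A i \<inter> {0..l})|?M. h x))"
      proof (intro lebesgue_integral_countable_add si s1)
        show "(A i \<inter> {0..l}) \<inter> (A j \<inter> {0..l}) = {}" if "i \<noteq> j" for i j
          using union that by (auto simp: disjoint_family_on_def)
        show "(\<Union>i. A i \<inter> {0..l}) \<in> sets ?M"
          using s1 by (rule sets.countable_UN[OF image_subsetI])
      qed
      also have "\<dots> = 0" using union by (simp add: P_def)
      finally show ?case by (simp add: P_def)
    qed
  qed
  \<comment> \<open>The measurable sets here are Lebesgue sets; each is a Borel set up to a part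
    contained in a Borel null set.\<close>
  fix A assume "A \<in> sets ?M"
  then have A: "A \<in> sets lebesgue" "A \<subseteq> {0..l}"
    by (auto simp: sets_restrict_space)
  define B where "B = main_part lborel A"
  have B: "B \<in> sets borel" using A(1) main_part_sets[of A lborel] by (auto simp: B_def)
  have N: "null_part lborel A \<subseteq> A" "A = B \<union> null_part lborel A"
    using main_part_null_part_Un[OF A(1)] unfolding B_def by blast+
  obtain N' where "N' \<in> null_sets lborel" "null_part lborel A \<subseteq> N'"
    using null_part[of A lborel] A(1) by auto
  then have "null_part lborel A \<in> null_sets lebesgue"
    using null_sets_completion_iff2 by blast
  then have "AE x in lebesgue. x \<notin> null_part lborel A"
    by (rule AE_not_in)
  then have ae: "AE x in ?M. x \<notin> null_part lborel A"
    by (auto simp: AE_restrict_space_iff)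
  have "set_lebesgue_integral ?M A h = set_lebesgue_integral ?M (B \<inter> {0..l}) h"
    unfolding set_lebesgue_integral_def
  proof (rule Bochner_Integration.integral_cong_AE)
    show "(\<lambda>x. indicat_real A x *\<^sub>R h x) \<in> borel_measurable ?M"
      using \<open>A \<in> sets ?M\<close> h by (intro borel_measurable_scaleR borel_measurable_indicator) auto
    show "(\<lambda>x. indicat_real (B \<inter> {0..l}) x *\<^sub>R h x) \<in> borel_measurable ?M"
      using setI[of B] B h by (intro borel_measurable_scaleR borel_measurable_indicator) auto
    show "AE x in ?M. indicat_real A x *\<^sub>R h x = indicat_real (B \<inter> {0..l}) x *\<^sub>R h x"
      using ae by eventually_elim (use N A(2) in \<open>auto split: split_indicator\<close>)
  qed
  then show "set_lebesgue_integral ?M A h = 0"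
    using borelP[of B] B by (simp add: P_def borel_eq_atMost)
qed

section \<open>Cut-off functions and the du Bois-Reymond lemma\<close>

lemma integrable_scaleR_continuous:
  fixes f :: "real \<Rightarrow> 'a::{banach, second_countable_topology}"
  assumes f: "integrable (lebesgue_on {0..l}) f" and d: "continuous_on UNIV (d :: real \<Rightarrow> real)"
  shows "integrable (lebesgue_on {0..l}) (\<lambda>x. d x *\<^sub>R f x)"
proof -
  have "compact (d ` {0..l})"
    using d by (intro compact_continuous_image) (auto intro: continuous_on_subset)
  then obtain B where B: "\<And>x. x \<in> {0..l} \<Longrightarrow> \<bar>d x\<bar> \<le> B"
    using compact_imp_bounded[of "d ` {0..l}"] unfolding bounded_iff real_norm_def by blast
  have dm: "d \<in> borel_measurable borel"
    using d by (rule borel_measurable_continuous_onI)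
  have [measurable]: "d \<in> borel_measurable (lebesgue_on {0..l})"
    by (rule measurable_restrict_space1) (use dm in \<open>auto intro: measurable_completion\<close>)
  show ?thesis
  proof (rule Bochner_Integration.integrable_bound)
    show "integrable (lebesgue_on {0..l}) (\<lambda>x. B *\<^sub>R norm (f x))" using f by auto
    show "(\<lambda>x. d x *\<^sub>R f x) \<in> borel_measurable (lebesgue_on {0..l})" using f by measurable
    show "AE x in lebesgue_on {0..l}. norm (d x *\<^sub>R f x) \<le> norm (B *\<^sub>R norm (f x))"
    proof (rule AE_I2)
      fix x assume "x \<in> space (lebesgue_on {0..l})"
      then have "\<bar>d x\<bar> \<le> \<bar>B\<bar>" using B[of x] by auto
      then show "norm (d x *\<^sub>R f x) \<le> norm (B *\<^sub>R norm (f x))"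
        by (simp add: abs_mult mult_right_mono)
    qed
  qed
qed

text \<open>Zero mean is exactly what makes the primitive vanish again to the right of the support,
  so that it is an admissible test function.\<close>

lemma primitive_test_function:
  fixes \<Psi> :: "real \<Rightarrow> real"
  assumes c: "continuous_on UNIV \<Psi>" and ab: "0 < \<alpha>" "\<beta> < l"
    and supp: "\<And>x. x \<notin> {\<alpha>..\<beta>} \<Longrightarrow> \<Psi> x = 0" and mean: "integral {0..l} \<Psi> = 0"
  obtains \<phi> where "\<phi> C1_differentiable_on UNIV" "closure {x. \<phi> x \<noteq> 0} \<subseteq> {0<..<l}"
    "\<And>x. vector_derivative \<phi> (at x) = \<Psi> x"
proof -
  \<comment> \<open>The lower limit is any point left of 0: \<open>\<Psi>\<close> vanishes there,
    and each x \<ge> \<open>\<alpha>\<close> becomes interior to \<open>{-1..x+1}\<close>, so that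
    the derivative within the interval is a full one.\<close>
  define \<phi> where "\<phi> = (\<lambda>x. integral {-1..x} \<Psi>)"
  have left: "\<phi> x = 0" if "x < \<alpha>" for x
    unfolding \<phi>_def using that supp by (intro integral_unique has_integral_is_0) auto
  have right: "\<phi> x = 0" if "\<beta> < x" for x
  proof -
    have "\<phi> x = integral UNIV \<Psi>"
      unfolding \<phi>_def
      by (subst Henstock_Kurzweil_Integration.integral_restrict_UNIV[symmetric])
         (use supp that ab in \<open>auto simp: fun_eq_iff intro!: arg_cong[where f = "integral UNIV"]\<close>)
    also have "\<dots> = integral {0..l} \<Psi>"
      by (subst (2) Henstock_Kurzweil_Integration.integral_restrict_UNIV[symmetric])
         (use supp that ab in \<open>auto simp: fun_eq_iff intro!: arg_cong[where f = "integral UNIV"]\<close>)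
    finally show ?thesis using mean by simp
  qed
  have der: "(\<phi> has_vector_derivative \<Psi> x) (at x)" for x
  proof (cases "x < \<alpha>")
    case True
    then have "((\<lambda>_. 0) has_vector_derivative \<Psi> x) (at x)"
      using supp[of x] by simp
    then show ?thesis
      by (rule has_vector_derivative_transform_within_open[of _ _ _ "{..<\<alpha>}"]) (use True left in auto)
  next
    case False
    then have "(\<phi> has_vector_derivative \<Psi> x) (at x within {-1..x+1})"
      unfolding \<phi>_def using ab continuous_on_subset[OF c]
      by (intro integral_has_vector_derivative) auto
    moreover have "at x within {-1..x+1} = at x"
      using False ab by (intro at_within_interior) auto
    ultimately show ?thesis by simp
  qed
  show ?thesis
  proof
    show "\<phi> C1_differentiable_on UNIV"
      unfolding C1_differentiable_on_def using der c by blast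
    have "{x. \<phi> x \<noteq> 0} \<subseteq> {\<alpha>..\<beta>}"
      using left right by (force simp: not_less)
    then have "closure {x. \<phi> x \<noteq> 0} \<subseteq> {\<alpha>..\<beta>}" by (rule closure_minimal) auto
    then show "closure {x. \<phi> x \<noteq> 0} \<subseteq> {0<..<l}" using ab by force
    show "vector_derivative \<phi> (at x) = \<Psi> x" for x
      using der by (rule vector_derivative_at)
  qed
qed

text \<open>A continuous approximation from below of the indicator of (0, b): for large
  \<open>n\<close> it is 0 outside [1/n, b - 1/n], 1 on [2/n, b - 2/n], and has slopes n and -n in
  between.\<close>

definition trapezoid :: "real \<Rightarrow> real \<Rightarrow> real \<Rightarrow> real" where
  "trapezoid n b x = max 0 (min 1 (min (n * x - 1) (n * (b - x) - 1)))"

lemma continuous_trapezoid: "continuous_on A (trapezoid n b)"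
  unfolding trapezoid_def by (intro continuous_intros)

lemma trapezoid_bounds: "0 \<le> trapezoid n b x" "trapezoid n b x \<le> 1"
  by (auto simp: trapezoid_def)

lemma trapezoid_support: "0 < n \<Longrightarrow> x \<notin> {1/n..b - 1/n} \<Longrightarrow> trapezoid n b x = 0"
  by (auto simp: trapezoid_def field_simps)

lemma trapezoid_LIMSEQ: "(\<lambda>n. trapezoid (real n) b x) \<longlonglongrightarrow> indicator {0<..<b} x"
proof (cases "x \<in> {0<..<b}")
  case True
  \<comment> \<open>From this index on, x is at distance at least 2/n from both ends, that is, on
    the plateau.\<close>
  obtain N where N: "2 / min x (b - x) < real N" using reals_Archimedean2 by blast
  have "trapezoid (real n) b x = 1" if "N \<le> n" for n
  proof -
    have "2 / min x (b - x) < n" using N that by simp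
    moreover have "0 < min x (b - x)" using True by simp
    ultimately have "2 < n * min x (b - x)" by (simp add: field_simps)
    moreover have "n * min x (b - x) \<le> n * x" "n * min x (b - x) \<le> n * (b - x)"
      by (auto intro!: mult_left_mono)
    ultimately show ?thesis by (simp add: trapezoid_def)
  qed
  then have "eventually (\<lambda>n. trapezoid (real n) b x = 1) sequentially"
    by (auto simp: eventually_sequentially)
  then show ?thesis using True by (simp add: tendsto_eventually)
next
  case False
  have "trapezoid (real n) b x = 0" for n
  proof (cases "x \<le> 0")
    case True
    then have "n * x \<le> 0" by (simp add: mult_nonneg_nonpos)
    then show ?thesis by (simp add: trapezoid_def)
  next
    case False
    then have "n * (b - x) \<le> 0" using \<open>x \<notin> _\<close> by (intro mult_nonneg_nonpos) auto
    then show ?thesis by (simp add: trapezoid_def)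
  qed
  then show ?thesis using False by simp
qed

lemma LINT_trapezoid_LIMSEQ:
  fixes g :: "real \<Rightarrow> 'a::{banach, second_countable_topology}"
  assumes g: "integrable (lebesgue_on {0..l}) g"
  shows "(\<lambda>n. LINT x|lebesgue_on {0..l}. trapezoid (real n) b x *\<^sub>R g x)
    \<longlonglongrightarrow> (LINT x|lebesgue_on {0..l}. indicator {0<..<b} x *\<^sub>R g x)"
proof (rule integral_dominated_convergence[where w = "\<lambda>x. norm (g x)"])
  show "(\<lambda>x. trapezoid (real n) b x *\<^sub>R g x) \<in> borel_measurable (lebesgue_on {0..l})" for n
    using integrable_scaleR_continuous[OF g continuous_trapezoid] by (rule borel_measurable_integrable)
  have "indicator {0<..<b} \<in> borel_measurable (lebesgue_on {0..l})"
    by (rule measurable_restrict_space1) (auto intro!: measurable_completion)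
  then show "(\<lambda>x. indicator {0<..<b} x *\<^sub>R g x) \<in> borel_measurable (lebesgue_on {0..l})"
    using g by measurable
  show "AE x in lebesgue_on {0..l}. (\<lambda>i. trapezoid (real i) b x *\<^sub>R g x) \<longlonglongrightarrow> indicator {0<..<b} x *\<^sub>R g x"
    by (intro AE_I2 tendsto_intros trapezoid_LIMSEQ)
  show "AE x in lebesgue_on {0..l}. norm (trapezoid (real i) b x *\<^sub>R g x) \<le> norm (g x)" for i
    by (intro AE_I2) (auto simp: trapezoid_bounds intro!: mult_left_le_one_le)
qed (use g in auto)

text \<open>Subtracting a multiple of one fixed bump \<open>\<rho>\<close> gives any trapezoid zero
  mean and makes it the derivative of a test function. So the integral of \<open>g\<close> against a
  trapezoid is a fixed \<open>c\<close> times the integral of the trapezoid. In the limit the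
  primitive of \<open>g - c\<close> vanishes.\<close>

lemma du_Bois_Reymond:
  fixes g :: "real \<Rightarrow> complex"
  assumes g: "integrable (lebesgue_on {0..l}) g" and l: "0 < l"
    and test: "\<And>\<phi>::real \<Rightarrow> real. \<phi> C1_differentiable_on UNIV \<Longrightarrow> closure {x. \<phi> x \<noteq> 0} \<subseteq> {0<..<l} \<Longrightarrow>
      (LINT x|lebesgue_on {0..l}. vector_derivative \<phi> (at x) *\<^sub>R g x) = 0"
  shows "\<exists>c. AE x in lebesgue_on {0..l}. g x = c"
proof -
  let ?M = "lebesgue_on {0..l}"
  \<comment> \<open>With slope 4/l the support is [l/4, 3l/4] and the value at the midpoint is 1, so
    the mean \<open>\<kappa>\<close> is non-zero.\<close>
  define \<rho> where "\<rho> = trapezoid (4 / l) l"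
  define \<kappa> where "\<kappa> = integral {0..l} \<rho>"
  define c where "c = (1 / \<kappa>) *\<^sub>R (LINT x|?M. \<rho> x *\<^sub>R g x)"
  have "\<rho> (l / 2) = 1" using l by (simp add: \<rho>_def trapezoid_def)
  then have "\<kappa> \<noteq> 0"
    unfolding \<kappa>_def using l
    by (subst integral_eq_0_iff) (auto simp: \<rho>_def continuous_trapezoid trapezoid_bounds intro!: bexI[of _ "l/2"])
  have key: "(LINT x|?M. trapezoid n b x *\<^sub>R g x) = (LINT x|?M. trapezoid n b x) *\<^sub>R c"
    if n: "0 < n" and b: "b \<le> l" for n b
  proof -
    \<comment> \<open>The multiple of \<open>\<rho>\<close> whose removal makes the mean of
      \<open>\<Psi>\<close> zero.\<close>
    define t where "t = integral {0..l} (trapezoid n b) / \<kappa>"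
    define \<Psi> where "\<Psi> = (\<lambda>x. trapezoid n b x - t * \<rho> x)"
    have cont: "continuous_on UNIV \<Psi>"
      unfolding \<Psi>_def \<rho>_def by (intro continuous_intros continuous_trapezoid)
    have supp: "\<Psi> x = 0" if "x \<notin> {min (1/n) (l/4)..max (b - 1/n) (l - l/4)}" for x
      using that trapezoid_support[OF n, of x b] trapezoid_support[of "4/l" x l] l
      by (auto simp: \<Psi>_def \<rho>_def not_le)
    have mean: "integral {0..l} \<Psi> = 0"
    proof -
      have "integral {0..l} \<Psi> = integral {0..l} (trapezoid n b) - integral {0..l} (\<lambda>x. t * \<rho> x)"
        unfolding \<Psi>_def \<rho>_def
        by (intro Henstock_Kurzweil_Integration.integral_diff integrable_continuous_real continuous_intros continuous_trapezoid)
      then show ?thesis using \<open>\<kappa> \<noteq> 0\<close> by (simp add: t_def \<kappa>_def)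
    qed
    have "0 < 1 / n" using n by simp
    then have "b - 1 / n < l" using b by linarith
    \<comment> \<open>The margin 1/n keeps the support away from \<open>l\<close> even for b =
      l.\<close>
    then have ends: "0 < min (1/n) (l/4)" "max (b - 1/n) (l - l/4) < l" using n l by auto
    obtain \<phi> where "\<phi> C1_differentiable_on UNIV" "closure {x. \<phi> x \<noteq> 0} \<subseteq> {0<..<l}"
      "\<And>x. vector_derivative \<phi> (at x) = \<Psi> x"
      using primitive_test_function[OF cont ends supp mean] by blast
    then have "(LINT x|?M. \<Psi> x *\<^sub>R g x) = 0" using test[of \<phi>] by simp
    moreover have "(LINT x|?M. \<Psi> x *\<^sub>R g x) =
        (LINT x|?M. trapezoid n b x *\<^sub>R g x) - t *\<^sub>R (LINT x|?M. \<rho> x *\<^sub>R g x)"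
      using integrable_scaleR_continuous[OF g continuous_trapezoid]
      by (simp add: \<Psi>_def \<rho>_def scaleR_diff_left Bochner_Integration.integral_diff flip: scaleR_scaleR)
    moreover have "(LINT x|?M. trapezoid n b x) = integral {0..l} (trapezoid n b)"
      by (intro lebesgue_integral_eq_integral continuous_imp_integrable_real continuous_trapezoid) auto
    ultimately show ?thesis by (simp add: c_def t_def)
  qed
  have gc: "integrable ?M (\<lambda>x. g x - c)" using g by simp
  have "integral {0..b} (\<lambda>x. g x - c) = 0" if b: "b \<in> {0..l}" for b
  proof -
    let ?i = "indicator {0<..<b} :: real \<Rightarrow> real"
    have one: "integrable ?M (\<lambda>x. 1::real)" by simp
    have A: "(\<lambda>n. LINT x|?M. trapezoid (real n) b x *\<^sub>R g x) \<longlonglongrightarrow> (LINT x|?M. ?i x *\<^sub>R g x)"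
      by (rule LINT_trapezoid_LIMSEQ[OF g])
    have B: "(\<lambda>n. (LINT x|?M. trapezoid (real n) b x *\<^sub>R 1) *\<^sub>R c) \<longlonglongrightarrow> (LINT x|?M. ?i x *\<^sub>R 1) *\<^sub>R c"
      by (intro tendsto_intros LINT_trapezoid_LIMSEQ[OF one])
    have "(LINT x|?M. trapezoid (real n) b x *\<^sub>R g x) = (LINT x|?M. trapezoid (real n) b x *\<^sub>R 1) *\<^sub>R c" if "0 < n" for n
      using key[of "real n" b] b that by simp
    then have "eventually (\<lambda>n. (LINT x|?M. trapezoid (real n) b x *\<^sub>R g x) = (LINT x|?M. trapezoid (real n) b x *\<^sub>R 1) *\<^sub>R c) sequentially"
      by (rule eventually_mono[OF eventually_gt_at_top[of 0]])
    then have eq: "(LINT x|?M. ?i x *\<^sub>R g x) = (LINT x|?M. ?i x *\<^sub>R 1) *\<^sub>R c"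
      by (rule LIMSEQ_unique[OF Lim_transform_eventually[OF A] B])
    have im: "?i \<in> borel_measurable ?M"
      by (rule measurable_restrict_space1) (auto intro!: measurable_completion)
    have i1: "integrable ?M ?i"
      by (rule Bochner_Integration.integrable_bound[OF one im]) (auto simp: indicator_def)
    have igm: "(\<lambda>x. ?i x *\<^sub>R g x) \<in> borel_measurable ?M"
      using im borel_measurable_integrable[OF g] by (rule borel_measurable_scaleR)
    have ig: "integrable ?M (\<lambda>x. ?i x *\<^sub>R g x)"
      by (rule Bochner_Integration.integrable_bound[OF g igm]) (auto simp: indicator_def)
    \<comment> \<open>The open interval of the limit and the closed one of the primitive differ only
      in these two points.\<close>
    have "{0, b} \<in> null_sets lebesgue"
      by (rule null_sets_completionI[OF finite_imp_null_set_lborel]) simp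
    then have "AE x in lebesgue. x \<notin> {0, b}"
      by (rule AE_not_in)
    then have ae: "AE x in ?M. x \<notin> {0, b}" by (auto simp: AE_restrict_space_iff)
    have "integral {0..b} (\<lambda>x. g x - c) = (LINT t|?M. (if t \<le> b then 1 else 0) *\<^sub>R (g t - c))"
      by (rule integral_prefix_eq_LINT[OF gc b])
    also have "\<dots> = (LINT t|?M. ?i t *\<^sub>R (g t - c))"
    proof (rule Bochner_Integration.integral_cong_AE)
      have "(\<lambda>t. if t \<le> b then 1 else 0 :: real) \<in> borel_measurable ?M"
        by (rule measurable_restrict_space1) (auto intro!: measurable_completion)
      then show "(\<lambda>t. (if t \<le> b then 1 else 0 :: real) *\<^sub>R (g t - c)) \<in> borel_measurable ?M"
        using gc by measurable
      show "(\<lambda>t. ?i t *\<^sub>R (g t - c)) \<in> borel_measurable ?M"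
        using gc im by measurable
      show "AE x in ?M. (if x \<le> b then 1 else 0 :: real) *\<^sub>R (g x - c) = ?i x *\<^sub>R (g x - c)"
        using ae AE_space by eventually_elim (auto simp: indicator_def)
    qed
    also have "\<dots> = (LINT t|?M. ?i t *\<^sub>R g t) - (LINT t|?M. ?i t) *\<^sub>R c"
      using ig i1 by (simp add: scaleR_diff_right)
    also have "\<dots> = 0" using eq by simp
    finally show ?thesis .
  qed
  then have "AE x in ?M. g x - c = 0"
    using l by (intro primitive_zero_imp_AE_zero[OF gc]) auto
  then show ?thesis by auto
qed

section \<open>From weak derivatives to classical ones\<close>

lemma continuous_AE_zero_imp_zero:
  fixes l :: real
  assumes "continuous_on {0..l} k" "AE x in lebesgue_on {0..l}. k x = 0" "0 < l" "x \<in> {0..l}"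
  shows "k x = (0::complex)"
proof -
  have c: "continuous_on {0..l} (\<lambda>x. norm (k x))" using assms(1) by (intro continuous_intros)
  have "integral {0..l} (\<lambda>x. norm (k x)) = (LINT x|lebesgue_on {0..l}. norm (k x))"
    by (rule lebesgue_integral_eq_integral[OF continuous_imp_integrable_real[OF c], symmetric]) auto
  also have "\<dots> = (LINT x|lebesgue_on {0..l}. 0)"
    using assms(2) continuous_imp_integrable_real[OF c] by (intro Bochner_Integration.integral_cong_AE) auto
  finally show ?thesis using integral_eq_0_iff[OF c] assms by auto
qed

lemma continuous_on_primitive:
  fixes h :: "real \<Rightarrow> complex"
  assumes "integrable (lebesgue_on {0..l}) h"
  shows "continuous_on {0..l} (\<lambda>x. integral {0..x} h)"
  using integrable_on_prefix[OF assms] by (intro indefinite_integral_continuous_1) auto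

lemma primitive_cong_AE:
  fixes h :: "real \<Rightarrow> complex"
  assumes h: "integrable (lebesgue_on {0..l}) h" "integrable (lebesgue_on {0..l}) k"
    and ae: "AE x in lebesgue_on {0..l}. h x = k x" and x: "x \<in> {0..l}"
  shows "integral {0..x} h = integral {0..x} k"
proof -
  have [measurable]: "(\<lambda>t. if t \<le> x then 1 else 0 :: real) \<in> borel_measurable (lebesgue_on {0..l})"
    by (rule measurable_restrict_space1) (auto intro!: measurable_completion)
  note [measurable] = borel_measurable_integrable[OF h(1)] borel_measurable_integrable[OF h(2)]
  show ?thesis unfolding integral_prefix_eq_LINT[OF h(1) x] integral_prefix_eq_LINT[OF h(2) x]
    by (rule Bochner_Integration.integral_cong_AE) (use ae in \<open>auto elim!: eventually_mono\<close>)
qed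

text \<open>\<open>f\<close> and the primitive of \<open>g\<close> have the same weak derivative, so
  the du Bois-Reymond lemma applies to their difference.\<close>

lemma is_weak_deriv_AE_primitive:
  assumes f: "integrable (lebesgue_on {0..l}) f" and g: "integrable (lebesgue_on {0..l}) g"
    and w: "is_weak_deriv l f g" and l: "0 < l"
  shows "\<exists>c. AE x in lebesgue_on {0..l}. f x = c + integral {0..x} g"
proof -
  let ?F = "\<lambda>x. integral {0..x} g"
  have F: "integrable (lebesgue_on {0..l}) ?F"
    by (rule continuous_imp_integrable_real[OF continuous_on_primitive[OF g]])
  have wF: "is_weak_deriv l ?F g"
    using l by (intro is_weak_deriv_primitive[OF g, where c = 0]) auto
  have "\<exists>c. AE x in lebesgue_on {0..l}. f x - ?F x = c"
  proof (rule du_Bois_Reymond[OF _ l])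
    show "integrable (lebesgue_on {0..l}) (\<lambda>x. f x - ?F x)" using f F by simp
    fix \<phi> :: "real \<Rightarrow> real"
    assume p: "\<phi> C1_differentiable_on UNIV" "closure {x. \<phi> x \<noteq> 0} \<subseteq> {0<..<l}"
    then have "continuous_on UNIV (\<lambda>x. vector_derivative \<phi> (at x))"
      by (auto simp: C1_differentiable_on_eq)
    note i = integrable_scaleR_continuous[OF f this] integrable_scaleR_continuous[OF F this]
    have "(LINT x|lebesgue_on {0..l}. vector_derivative \<phi> (at x) *\<^sub>R f x) =
          (LINT x|lebesgue_on {0..l}. vector_derivative \<phi> (at x) *\<^sub>R ?F x)"
      using w[unfolded is_weak_deriv_def, rule_format, of \<phi>] wF[unfolded is_weak_deriv_def, rule_format, of \<phi>] p
      by simp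
    then show "(LINT x|lebesgue_on {0..l}. vector_derivative \<phi> (at x) *\<^sub>R (f x - ?F x)) = 0"
      using i by (simp add: scaleR_diff_right)
  qed
  then obtain c where "AE x in lebesgue_on {0..l}. f x - ?F x = c" by blast
  then have "AE x in lebesgue_on {0..l}. f x = c + ?F x" by (simp add: algebra_simps)
  then show ?thesis by blast
qed

lemma is_weak_deriv_cong_AE:
  assumes f: "integrable (lebesgue_on {0..l}) f" "integrable (lebesgue_on {0..l}) f'"
    and ae: "AE x in lebesgue_on {0..l}. f x = f' x" and w: "is_weak_deriv l f g"
  shows "is_weak_deriv l f' g"
  unfolding is_weak_deriv_def
proof (intro allI impI, elim conjE)
  fix \<phi> :: "real \<Rightarrow> real"
  assume p: "\<phi> C1_differentiable_on UNIV" "closure {x. \<phi> x \<noteq> 0} \<subseteq> {0<..<l}"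
  then have d: "continuous_on UNIV (\<lambda>x. vector_derivative \<phi> (at x))"
    by (auto simp: C1_differentiable_on_eq)
  have "(LINT x|lebesgue_on {0..l}. vector_derivative \<phi> (at x) *\<^sub>R f' x) =
        (LINT x|lebesgue_on {0..l}. vector_derivative \<phi> (at x) *\<^sub>R f x)"
    using ae integrable_scaleR_continuous[OF f(1) d] integrable_scaleR_continuous[OF f(2) d]
    by (intro Bochner_Integration.integral_cong_AE) (auto elim!: eventually_mono)
  then show "(LINT x|lebesgue_on {0..l}. vector_derivative \<phi> (at x) *\<^sub>R f' x) =
     - (LINT x|lebesgue_on {0..l}. \<phi> x *\<^sub>R g x)"
    using w p by (simp add: is_weak_deriv_def)
qed

text \<open>Both primitives represent \<open>f\<close> up to constants; continuity turns the
  almost-everywhere identity into a pointwise one, x = 0 identifies the constants, and equal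
  primitives have almost everywhere equal integrands.\<close>

lemma is_weak_deriv_unique_AE:
  assumes f: "integrable (lebesgue_on {0..l}) f"
    and g: "integrable (lebesgue_on {0..l}) g" "integrable (lebesgue_on {0..l}) g'"
    and w: "is_weak_deriv l f g" "is_weak_deriv l f g'" and l: "0 < l"
  shows "AE x in lebesgue_on {0..l}. g x = g' x"
proof -
  let ?M = "lebesgue_on {0..l}"
  obtain c where c: "AE x in ?M. f x = c + integral {0..x} g"
    using is_weak_deriv_AE_primitive[OF f g(1) w(1) l] by blast
  obtain c' where c': "AE x in ?M. f x = c' + integral {0..x} g'"
    using is_weak_deriv_AE_primitive[OF f g(2) w(2) l] by blast
  have z: "(c + integral {0..x} g) - (c' + integral {0..x} g') = 0" if "x \<in> {0..l}" for x
    using _ _ l that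
  proof (rule continuous_AE_zero_imp_zero)
    show "continuous_on {0..l} (\<lambda>x. (c + integral {0..x} g) - (c' + integral {0..x} g'))"
      using g by (intro continuous_intros continuous_on_primitive)
    show "AE x in ?M. (c + integral {0..x} g) - (c' + integral {0..x} g') = 0"
      using c c' by eventually_elim simp
  qed
  have "c = c'" using z[of 0] l by simp
  have "AE x in ?M. g x - g' x = 0"
  proof (rule primitive_zero_imp_AE_zero)
    show "integrable ?M (\<lambda>x. g x - g' x)" using g by simp
    show "integral {0..x} (\<lambda>x. g x - g' x) = 0" if "x \<in> {0..l}" for x
      using z[OF that] \<open>c = c'\<close> that integrable_on_prefix[OF g(1)] integrable_on_prefix[OF g(2)]
      by (simp add: Henstock_Kurzweil_Integration.integral_diff)
  qed (use l in simp)
  then show ?thesis by simp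
qed

lemma weak_deriv_AE:
  assumes "f \<in> L2_interval l" "g \<in> L2_interval l" "is_weak_deriv l f g" "0 < l"
  shows "weak_deriv l f \<in> L2_interval l" "AE x in lebesgue_on {0..l}. weak_deriv l f x = g x"
proof -
  have *: "weak_deriv l f \<in> L2_interval l \<and> is_weak_deriv l f (weak_deriv l f)"
    unfolding weak_deriv_def
    using someI[of "\<lambda>g. g \<in> L2_interval l \<and> is_weak_deriv l f g" g] assms by simp
  then show "weak_deriv l f \<in> L2_interval l" by simp
  show "AE x in lebesgue_on {0..l}. weak_deriv l f x = g x"
    using * assms by (intro is_weak_deriv_unique_AE[of l f]) (auto intro: L2_interval_integrable)
qed

text \<open>The inner \<open>weak_deriv\<close> is an arbitrary choice that agrees with
  \<open>f1\<close> only almost everywhere, so \<open>f2\<close> has to be transferred to it before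
  the outer choice can be identified.\<close>

lemma weak_deriv2_AE:
  assumes "f \<in> L2_interval l" "f1 \<in> L2_interval l" "f2 \<in> L2_interval l"
    "is_weak_deriv l f f1" "is_weak_deriv l f1 f2" "0 < l"
  shows "AE x in lebesgue_on {0..l}. weak_deriv l (weak_deriv l f) x = f2 x"
proof -
  note 1 = weak_deriv_AE[OF assms(1,2,4,6)]
  have "is_weak_deriv l (weak_deriv l f) f2"
  proof (rule is_weak_deriv_cong_AE[where f = f1])
    show "AE x in lebesgue_on {0..l}. f1 x = weak_deriv l f x"
      using 1(2) by eventually_elim simp
  qed (use 1(1) assms L2_interval_integrable in auto)
  then show ?thesis by (rule weak_deriv_AE(2)[OF 1(1) assms(3) _ assms(6)])
qed

lemma L2_interval_continuous:
  assumes "continuous_on {0..l} f"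
  shows "f \<in> L2_interval l"
proof -
  have "integrable (lebesgue_on {0..l}) f" using assms by (rule continuous_imp_integrable_real)
  moreover have "integrable (lebesgue_on {0..l}) (\<lambda>x. (norm (f x))\<^sup>2)"
    using assms by (intro continuous_imp_integrable_real continuous_intros)
  ultimately show ?thesis by (auto simp: L2_interval_def)
qed

text \<open>Regularity: the first weak derivative is replaced by its continuous representative
  \<open>f1\<close>, and continuity of \<open>f\<close> makes its representation as a primitive
  exact. With the converse \<open>H2_intervalI\<close> this takes the choice operator out of the
  later arguments.\<close>

lemma H2_intervalD:
  assumes f: "f \<in> H2_interval l" and cf: "continuous_on {0..l} f" and l: "0 < l"
  obtains f1 h where "h \<in> L2_interval l"
    "\<And>x. x \<in> {0..l} \<Longrightarrow> (f has_vector_derivative f1 x) (at x within {0..l})"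
    "\<And>x. x \<in> {0..l} \<Longrightarrow> f1 x = f1 0 + integral {0..x} h"
    "AE x in lebesgue_on {0..l}. weak_deriv l (weak_deriv l f) x = h x"
proof -
  let ?M = "lebesgue_on {0..l}"
  obtain g h where gh: "f \<in> L2_interval l" "g \<in> L2_interval l" "h \<in> L2_interval l"
    "is_weak_deriv l f g" "is_weak_deriv l g h"
    using f by (auto simp: H2_interval_def)
  note int = gh(1-3)[THEN L2_interval_integrable]
  obtain c1 where c1: "AE x in ?M. g x = c1 + integral {0..x} h"
    using is_weak_deriv_AE_primitive[OF int(2,3) gh(5) l] by blast
  obtain c0 where c0: "AE x in ?M. f x = c0 + integral {0..x} g"
    using is_weak_deriv_AE_primitive[OF int(1,2) gh(4) l] by blast
  define f1 where "f1 = (\<lambda>x. c1 + integral {0..x} h)"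
  have cf1: "continuous_on {0..l} f1"
    unfolding f1_def by (intro continuous_intros continuous_on_primitive int)
  have f1i: "integrable ?M f1" using cf1 by (rule continuous_imp_integrable_real)
  \<comment> \<open>Primitives do not see null sets, so \<open>g\<close> may be exchanged for its
    continuous representative.\<close>
  have eq: "integral {0..x} g = integral {0..x} f1" if "x \<in> {0..l}" for x
    using int(2) f1i c1 that by (intro primitive_cong_AE) (auto simp: f1_def)
  have "AE x in ?M. f x - (c0 + integral {0..x} f1) = 0"
    using c0 AE_space by eventually_elim (simp add: eq)
  then have "f x - (c0 + integral {0..x} f1) = 0" if "x \<in> {0..l}" for x
    using that l by (rule_tac continuous_AE_zero_imp_zero) (auto intro!: continuous_intros continuous_on_primitive f1i cf)
  then have fx: "f x = c0 + integral {0..x} f1" if "x \<in> {0..l}" for x using that by simp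
  show ?thesis
  proof
    show "h \<in> L2_interval l" by fact
    show "(f has_vector_derivative f1 x) (at x within {0..l})" if x: "x \<in> {0..l}" for x
    proof (rule has_vector_derivative_transform[OF x fx])
      show "((\<lambda>x. c0 + integral {0..x} f1) has_vector_derivative f1 x) (at x within {0..l})"
        using has_vector_derivative_add[OF has_vector_derivative_const integral_has_vector_derivative[OF cf1 x]]
        by simp
    qed
    show "f1 x = f1 0 + integral {0..x} h" for x by (simp add: f1_def)
    show "AE x in ?M. weak_deriv l (weak_deriv l f) x = h x"
      by (rule weak_deriv2_AE[OF gh l])
  qed
qed

lemma H2_intervalI:
  assumes h: "h \<in> L2_interval l" and l: "0 < l"
    and f: "\<And>x. x \<in> {0..l} \<Longrightarrow> (f has_vector_derivative f1 x) (at x within {0..l})"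
    and f1: "\<And>x. x \<in> {0..l} \<Longrightarrow> f1 x = f1 0 + integral {0..x} h"
  shows "f \<in> H2_interval l" "continuous_on {0..l} f"
    "AE x in lebesgue_on {0..l}. weak_deriv l (weak_deriv l f) x = h x"
proof -
  show cf: "continuous_on {0..l} f"
    using f by (rule continuous_on_vector_derivative)
  have "continuous_on {0..l} (\<lambda>x. f1 0 + integral {0..x} h)"
    by (intro continuous_intros continuous_on_primitive L2_interval_integrable h)
  then have cf1: "continuous_on {0..l} f1" by (rule continuous_on_eq) (rule f1[symmetric])
  have L: "f \<in> L2_interval l" "f1 \<in> L2_interval l" using cf cf1 by (auto intro: L2_interval_continuous)
  have w2: "is_weak_deriv l f1 h"
    by (rule is_weak_deriv_primitive[OF L2_interval_integrable[OF h] less_imp_le[OF l] f1])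
  have w1: "is_weak_deriv l f f1"
  proof (rule is_weak_deriv_primitive[OF L2_interval_integrable[OF L(2)]])
    fix x assume x: "x \<in> {0..l}"
    have "(f1 has_integral f x - f 0) {0..x}"
    proof (rule fundamental_theorem_of_calculus)
      show "(f has_vector_derivative f1 t) (at t within {0..x})" if "t \<in> {0..x}" for t
        by (rule has_vector_derivative_within_subset[OF f]) (use that x in auto)
    qed (use x in simp)
    then show "f x = f 0 + integral {0..x} f1" by (simp add: integral_unique)
  qed (use l in simp)
  show "f \<in> H2_interval l" using L h w1 w2 by (auto simp: H2_interval_def)
  show "AE x in lebesgue_on {0..l}. weak_deriv l (weak_deriv l f) x = h x"
    by (rule weak_deriv2_AE[OF L h w1 w2 l])
qed

section \<open>The equation on one edge\<close>

text \<open>\<open>ode_cos w\<close> and \<open>ode_sin w\<close> are the solutions of y'' = w y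
  with Cauchy data (1, 0) and (0, 1) at 0. For w = -k^2 they are cos(k x) and sin(k x)/k, whence the
  names; the removable singularity of the second at w = 0 is filled by x.\<close>

definition ode_cos :: "complex \<Rightarrow> real \<Rightarrow> complex" where
  "ode_cos w x = cosh (csqrt w * of_real x)"

definition ode_sin :: "complex \<Rightarrow> real \<Rightarrow> complex" where
  "ode_sin w x = (if w = 0 then of_real x else sinh (csqrt w * of_real x) / csqrt w)"

lemma ode_cos_0 [simp]: "ode_cos w 0 = 1" and ode_sin_0 [simp]: "ode_sin w 0 = 0"
  by (auto simp: ode_cos_def ode_sin_def)

text \<open>The left-hand side is the Wronskian of the two fundamental solutions.\<close>

lemma ode_pythagoras: "(ode_cos w x)\<^sup>2 - w * (ode_sin w x)\<^sup>2 = 1"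
proof (cases "w = 0")
  case False
  then show ?thesis
    by (simp add: ode_cos_def ode_sin_def power_divide cosh_square_eq)
qed (simp add: ode_cos_def)

lemma has_vector_derivative_ode_cos [derivative_intros]:
  "(ode_cos w has_vector_derivative w * ode_sin w x) (at x within S)"
proof -
  have "((\<lambda>z. cosh (csqrt w * z)) has_field_derivative csqrt w * sinh (csqrt w * of_real x)) (at (of_real x))"
    by (auto intro!: derivative_eq_intros)
  then have "((\<lambda>t. cosh (csqrt w * of_real t)) has_vector_derivative csqrt w * sinh (csqrt w * of_real x)) (at x within S)"
    by (rule has_vector_derivative_real_field[THEN has_vector_derivative_at_within])
  moreover have "csqrt w * sinh (csqrt w * of_real x) = w * ode_sin w x"
  proof (cases "w = 0")
    case False
    have "w = csqrt w * csqrt w" by (metis power2_csqrt power2_eq_square)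
    then show ?thesis using False by (simp add: ode_sin_def field_simps)
  qed simp
  ultimately show ?thesis by (simp add: ode_cos_def[abs_def])
qed

lemma has_vector_derivative_ode_sin [derivative_intros]:
  "(ode_sin w has_vector_derivative ode_cos w x) (at x within S)"
proof (cases "w = 0")
  case True
  have "(of_real has_vector_derivative (1::complex)) (at x within S)"
    using has_vector_derivative_of_real[OF DERIV_ident] by simp
  then show ?thesis using True by (simp add: ode_sin_def[abs_def] ode_cos_def)
next
  case False
  have "((\<lambda>z. sinh (csqrt w * z) / csqrt w) has_field_derivative cosh (csqrt w * of_real x)) (at (of_real x))"
    using False by (auto intro!: derivative_eq_intros)
  then have "((\<lambda>t. sinh (csqrt w * of_real t) / csqrt w) has_vector_derivative cosh (csqrt w * of_real x)) (at x within S)"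
    by (rule has_vector_derivative_real_field[THEN has_vector_derivative_at_within])
  then show ?thesis using False by (simp add: ode_sin_def[abs_def] ode_cos_def)
qed

lemma continuous_ode [continuous_intros]:
  "continuous_on S (ode_cos w)" "continuous_on S (ode_sin w)"
  by (rule continuous_on_vector_derivative, rule has_vector_derivative_ode_cos has_vector_derivative_ode_sin)+

text \<open>Only even powers of \<open>csqrt w\<close> occur, so the branch cut of \<open>csqrt\<close> is harmless.\<close>

lemma ode_cos_sums: "(\<lambda>n. (of_real x ^ (2*n) / fact (2*n)) * w ^ n) sums ode_cos w x"
proof -
  let ?f = "\<lambda>n. if even n then (csqrt w * of_real x) ^ n /\<^sub>R fact n else 0"
  have "(\<lambda>n. ?f (2 * n)) sums cosh (csqrt w * of_real x) \<longleftrightarrow> ?f sums cosh (csqrt w * of_real x)"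
    by (rule sums_mono_reindex) (auto simp: strict_mono_def elim!: evenE)
  with cosh_converges have "(\<lambda>n. ?f (2 * n)) sums ode_cos w x" by (simp add: ode_cos_def)
  moreover have "?f (2 * n) = (of_real x ^ (2*n) / fact (2*n)) * w ^ n" for n
  proof -
    have "(csqrt w * of_real x) ^ (2 * n) = w ^ n * of_real x ^ (2*n)"
      unfolding power_mult_distrib by (simp add: power_mult)
    then show ?thesis by (simp add: scaleR_conv_of_real divide_inverse mult_ac del: fact_Suc)
  qed
  ultimately show ?thesis by simp
qed

text \<open>The odd series carries one surplus factor \<open>csqrt w\<close>, which the division in
  \<open>ode_sin\<close> cancels; at w = 0 only the term n = 0 survives and gives x.\<close>

lemma ode_sin_sums: "(\<lambda>n. (of_real x ^ (2*n+1) / fact (2*n+1)) * w ^ n) sums ode_sin w x"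
proof (cases "w = 0")
  case True
  have "(\<lambda>n. (of_real x ^ (2*n+1) / fact (2*n+1)) * 0 ^ n) sums (of_real x ^ (2*0+1) / fact (2*0+1) :: complex)"
    by (rule powser_sums_zero)
  then show ?thesis using True by (simp add: ode_sin_def)
next
  case False
  let ?f = "\<lambda>n. if even n then 0 else (csqrt w * of_real x) ^ n /\<^sub>R fact n"
  have "(\<lambda>n. ?f (2 * n + 1)) sums sinh (csqrt w * of_real x) \<longleftrightarrow> ?f sums sinh (csqrt w * of_real x)"
    by (rule sums_mono_reindex) (auto simp: strict_mono_def elim!: oddE)
  with sinh_converges have "(\<lambda>n. ?f (2 * n + 1)) sums sinh (csqrt w * of_real x)" by simp
  from sums_divide[OF this, of "csqrt w"] False
  have "(\<lambda>n. ?f (2 * n + 1) / csqrt w) sums ode_sin w x" by (simp add: ode_sin_def)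
  moreover have "?f (2 * n + 1) / csqrt w = (of_real x ^ (2*n+1) / fact (2*n+1)) * w ^ n" for n
  proof -
    let ?X = "of_real x ^ (2*n+1) :: complex"
    have eq: "(csqrt w * of_real x) ^ (2 * n + 1) = csqrt w * (w ^ n * ?X)"
      unfolding power_mult_distrib by (simp add: power_mult)
    have "?f (2 * n + 1) / csqrt w = (csqrt w * (w ^ n * ?X)) /\<^sub>R fact (2*n+1) / csqrt w"
      unfolding eq by simp
    also have "\<dots> = (w ^ n * ?X) /\<^sub>R fact (2*n+1)" using False by (simp add: scaleR_conv_of_real)
    also have "\<dots> = (?X / fact (2*n+1)) * w ^ n"
      by (simp add: scaleR_conv_of_real divide_inverse mult_ac del: fact_Suc power_Suc)
    finally show ?thesis .
  qed
  ultimately show ?thesis by simp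
qed

text \<open>The closed forms cannot be differentiated in w across the branch cut of
  \<open>csqrt\<close>; the power series converge for every w and can be differentiated
  termwise.\<close>

lemma ode_entire:
  "\<exists>D. ((\<lambda>w. ode_cos w x) has_field_derivative D) (at w)"
  "\<exists>D. ((\<lambda>w. ode_sin w x) has_field_derivative D) (at w)"
proof -
  have "(\<lambda>w. ode_cos w x) = (\<lambda>w. \<Sum>n. (of_real x ^ (2*n) / fact (2*n)) * w ^ n)"
    using ode_cos_sums by (simp add: sums_iff)
  moreover note termdiffs_strong_converges_everywhere[OF ode_cos_sums[THEN sums_summable, of x]]
  ultimately show "\<exists>D. ((\<lambda>w. ode_cos w x) has_field_derivative D) (at w)" by metis
  have "(\<lambda>w. ode_sin w x) = (\<lambda>w. \<Sum>n. (of_real x ^ (2*n+1) / fact (2*n+1)) * w ^ n)"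
    using ode_sin_sums by (simp add: sums_iff)
  moreover note termdiffs_strong_converges_everywhere[OF ode_sin_sums[THEN sums_summable, of x]]
  ultimately show "\<exists>D. ((\<lambda>w. ode_sin w x) has_field_derivative D) (at w)" by metis
qed

lemma has_vector_derivative_zero_on_interval:
  fixes f :: "real \<Rightarrow> complex"
  assumes "\<And>x. x \<in> {0..l} \<Longrightarrow> (f has_vector_derivative 0) (at x within {0..l})" "x \<in> {0..l}"
  shows "f x = f 0"
proof -
  obtain c where "\<And>x. x \<in> {0..l} \<Longrightarrow> f x = c"
    using has_vector_derivative_zero_constant[OF _ assms(1)] by (metis convex_real_interval(5))
  then show ?thesis using assms(2) by simp
qed

text \<open>Solving for \<open>(f, f1)\<close> in the two first integrals \<open>f C - f1 S\<close> and \<open>f1 C - w f S\<close>.\<close>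

lemma ode_unique:
  fixes f f1 :: "real \<Rightarrow> complex"
  assumes f: "\<And>x. x \<in> {0..l} \<Longrightarrow> (f has_vector_derivative f1 x) (at x within {0..l})"
    and f1: "\<And>x. x \<in> {0..l} \<Longrightarrow> (f1 has_vector_derivative w * f x) (at x within {0..l})"
    and x: "x \<in> {0..l}"
  shows "f x = f 0 * ode_cos w x + f1 0 * ode_sin w x"
proof -
  let ?C = "ode_cos w" and ?S = "ode_sin w"
  have 1: "f x * ?C x - f1 x * ?S x = f 0 * ?C 0 - f1 0 * ?S 0"
    by (rule has_vector_derivative_zero_on_interval[OF _ x, of "\<lambda>x. f x * ?C x - f1 x * ?S x"])
       (auto intro!: derivative_eq_intros f f1 simp: algebra_simps)
  have 2: "f1 x * ?C x - w * (f x * ?S x) = f1 0 * ?C 0 - w * (f 0 * ?S 0)"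
    by (rule has_vector_derivative_zero_on_interval[OF _ x, of "\<lambda>x. f1 x * ?C x - w * (f x * ?S x)"])
       (auto intro!: derivative_eq_intros f f1 simp: algebra_simps)
  have p: "(?C x)\<^sup>2 - w * (?S x)\<^sup>2 = 1" by (rule ode_pythagoras)
  \<comment> \<open>The two first integrals form a linear system for (\<open>f x\<close>,
    \<open>f1 x\<close>) whose determinant is the Wronskian 1; this is Cramer's rule.\<close>
  have "f x = f x * ((?C x)\<^sup>2 - w * (?S x)\<^sup>2)" using p by simp
  also have "\<dots> = (f x * ?C x - f1 x * ?S x) * ?C x + (f1 x * ?C x - w * (f x * ?S x)) * ?S x"
    by (simp add: algebra_simps power2_eq_square)
  finally show "f x = f 0 * ?C x + f1 0 * ?S x" using 1 2 by simp
qed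

lemma norm_primitive_le:
  fixes h :: "real \<Rightarrow> complex"
  assumes h: "integrable (lebesgue_on {0..l}) h" and x: "x \<in> {0..l}"
  shows "norm (integral {0..x} h) \<le> (LINT t|lebesgue_on {0..l}. norm (h t))"
proof -
  have [measurable]: "(\<lambda>t. if t \<le> x then 1 else 0 :: real) \<in> borel_measurable (lebesgue_on {0..l})"
    by (rule measurable_restrict_space1) (auto intro!: measurable_completion)
  have m: "(\<lambda>t. (if t \<le> x then 1 else 0 :: real) *\<^sub>R h t) \<in> borel_measurable (lebesgue_on {0..l})"
    using borel_measurable_integrable[OF h] by measurable
  have i: "integrable (lebesgue_on {0..l}) (\<lambda>t. (if t \<le> x then 1 else 0 :: real) *\<^sub>R h t)"
    by (rule Bochner_Integration.integrable_bound[OF h m]) auto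
  have "norm (integral {0..x} h) \<le> (LINT t|lebesgue_on {0..l}. norm ((if t \<le> x then 1 else 0 :: real) *\<^sub>R h t))"
    unfolding integral_prefix_eq_LINT[OF h x] by (rule integral_norm_bound)
  also have "\<dots> \<le> (LINT t|lebesgue_on {0..l}. norm (h t))"
    by (rule integral_mono[OF integrable_norm[OF i] integrable_norm[OF h]]) auto
  finally show ?thesis .
qed

lemma norm_integral_continuous_le:
  fixes k :: "real \<Rightarrow> complex"
  assumes k: "continuous_on {0..l} k" and B: "\<And>t. t \<in> {0..l} \<Longrightarrow> norm (k t) \<le> B" and x: "x \<in> {0..l}"
  shows "norm (integral {0..x} k) \<le> B * l"
proof -
  have "0 \<le> B" using B[OF x] norm_ge_zero order_trans by blast
  have "norm (integral {0..x} k) \<le> B * (x - 0)"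
    using x B by (intro integral_bound continuous_on_subset[OF k]) auto
  also have "\<dots> \<le> B * l" using x \<open>0 \<le> B\<close> by (intro mult_left_mono) auto
  finally show ?thesis .
qed

text \<open>
  With \<open>H\<close> the second primitive of \<open>h\<close>, the function \<open>v = u - H\<close> has to solve \<open>v'' = w v + w H\<close>,
  whose right-hand side is continuous; so variation of parameters applies classically.
\<close>

lemma ode_particular:
  fixes w :: complex
  assumes l: "0 \<le> l"
  shows "\<exists>K\<ge>0. \<forall>h. integrable (lebesgue_on {0..l}) h \<longrightarrow> (\<exists>u u1. u1 0 = 0 \<and>
    (\<forall>x\<in>{0..l}. (u has_vector_derivative u1 x) (at x within {0..l}) \<and>
       u1 x = integral {0..x} (\<lambda>t. w * u t + h t) \<and>
       norm (u x) \<le> K * (LINT t|lebesgue_on {0..l}. norm (h t)) \<and>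
       norm (u1 x) \<le> K * (LINT t|lebesgue_on {0..l}. norm (h t))))"
proof -
  let ?C = "ode_cos w" and ?S = "ode_sin w" and ?I = "{0..l}"
  have "bounded (?C ` ?I \<union> ?S ` ?I)"
    unfolding bounded_Un by (intro conjI compact_imp_bounded compact_continuous_image continuous_ode compact_Icc)
  then obtain B where B: "\<And>x. x \<in> ?I \<Longrightarrow> norm (?C x) \<le> B" "\<And>x. x \<in> ?I \<Longrightarrow> norm (?S x) \<le> B"
    unfolding bounded_iff by blast
  have "0 \<le> B" using B(1)[of 0] l norm_ge_zero order_trans by fastforce
  \<comment> \<open>Bounds \<open>P\<close> and \<open>R\<close> per unit of \<open>N\<close>: |H|
    \<le> N l, a factor B from the fundamental solution, and a factor l from integrating.\<close>
  define Q where "Q = B * l * l"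
  \<comment> \<open>The first two summands bound \<open>u\<close>, the last two bound
    \<open>u1\<close>; none of them depends on \<open>h\<close>.\<close>
  define K where "K = l + norm w * (2 * B * Q) + 1 + norm w * (B * Q + norm w * B * Q)"
  have "0 \<le> Q" using \<open>0 \<le> B\<close> l by (simp add: Q_def)
  have "0 \<le> K" using \<open>0 \<le> B\<close> \<open>0 \<le> Q\<close> l by (simp add: K_def)
  show ?thesis
  proof (intro exI[of _ K] conjI allI impI)
    fix h :: "real \<Rightarrow> complex"
    assume h: "integrable (lebesgue_on ?I) h"
    define N where "N = (LINT t|lebesgue_on ?I. norm (h t))"
    have "0 \<le> N" unfolding N_def by simp
    define J where "J = (\<lambda>x. integral {0..x} h)"
    define H where "H = (\<lambda>x. integral {0..x} J)"
    define P where "P = (\<lambda>x. integral {0..x} (\<lambda>t. ?C t * H t))"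
    define R where "R = (\<lambda>x. integral {0..x} (\<lambda>t. ?S t * H t))"
    \<comment> \<open>By the addition theorem, S(x - t) = S(x) C(t) - C(x) S(t); so the bracket is
      the integral of S(x - t) H(t) over [0, x], the Duhamel formula for v'' = w v + H with zero
      data.\<close>
    define u where "u = (\<lambda>x. H x + w * (?S x * P x - ?C x * R x))"
    define u1 where "u1 = (\<lambda>x. J x + w * (?C x * P x - w * ?S x * R x))"
    have J: "norm (J x) \<le> N" if "x \<in> ?I" for x
      using norm_primitive_le[OF h that] by (simp add: J_def N_def)
    have Jc: "continuous_on ?I J"
      unfolding J_def by (rule continuous_on_primitive[OF h])
    have Hd: "(H has_vector_derivative J x) (at x within ?I)" if "x \<in> ?I" for x
      unfolding H_def by (rule integral_has_vector_derivative[OF Jc that])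
    have Hc: "continuous_on ?I H" using Hd by (rule continuous_on_vector_derivative)
    have H: "norm (H x) \<le> N * l" if "x \<in> ?I" for x
      unfolding H_def by (rule norm_integral_continuous_le[OF Jc J that])
    have c: "continuous_on ?I (\<lambda>t. ?C t * H t)" "continuous_on ?I (\<lambda>t. ?S t * H t)"
      by (intro continuous_intros Hc)+
    have Pd: "(P has_vector_derivative ?C x * H x) (at x within ?I)" if "x \<in> ?I" for x
      unfolding P_def by (rule integral_has_vector_derivative[OF c(1) that])
    have Rd: "(R has_vector_derivative ?S x * H x) (at x within ?I)" if "x \<in> ?I" for x
      unfolding R_def by (rule integral_has_vector_derivative[OF c(2) that])
    have P: "norm (P x) \<le> Q * N" if "x \<in> ?I" for x
    proof -
      have "norm (P x) \<le> B * (N * l) * l"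
        unfolding P_def
        by (rule norm_integral_continuous_le[OF c(1) _ that])
           (use B(1) H \<open>0 \<le> B\<close> in \<open>auto simp: norm_mult intro!: mult_mono\<close>)
      then show ?thesis by (simp add: Q_def mult_ac)
    qed
    have R: "norm (R x) \<le> Q * N" if "x \<in> ?I" for x
    proof -
      have "norm (R x) \<le> B * (N * l) * l"
        unfolding R_def
        by (rule norm_integral_continuous_le[OF c(2) _ that])
           (use B(2) H \<open>0 \<le> B\<close> in \<open>auto simp: norm_mult intro!: mult_mono\<close>)
      then show ?thesis by (simp add: Q_def mult_ac)
    qed
    have ud: "(u has_vector_derivative u1 x) (at x within ?I)" if "x \<in> ?I" for x
      unfolding u_def u1_def
      by (rule derivative_eq_intros Hd Pd Rd that refl)+ (simp add: algebra_simps)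
    have uc: "continuous_on ?I u" using ud by (rule continuous_on_vector_derivative)
    \<comment> \<open>Only \<open>u1 - J\<close> is differentiable in the classical sense;
      \<open>J\<close> is merely a primitive of \<open>h\<close> and is added after integrating. The
      terms with \<open>H\<close> combine through the Wronskian.\<close>
    have u1d: "((\<lambda>x. w * (?C x * P x - w * ?S x * R x)) has_vector_derivative w * u x) (at x within ?I)"
      if "x \<in> ?I" for x
    proof -
      have "((\<lambda>x. w * (?C x * P x - w * ?S x * R x)) has_vector_derivative
          w * (w * ?S x * P x - w * ?C x * R x + H x * ((?C x)\<^sup>2 - w * (?S x)\<^sup>2))) (at x within ?I)"
        by (rule derivative_eq_intros Pd Rd that refl)+ (simp add: algebra_simps power2_eq_square)
      then show ?thesis by (simp add: ode_pythagoras u_def algebra_simps)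
    qed
    have u1x: "u1 x = integral {0..x} (\<lambda>t. w * u t + h t)" if x: "x \<in> ?I" for x
    proof -
      have "((\<lambda>t. w * u t) has_integral
          (w * (?C x * P x - w * ?S x * R x)) - (w * (?C 0 * P 0 - w * ?S 0 * R 0))) {0..x}"
      proof (rule fundamental_theorem_of_calculus)
        show "((\<lambda>x. w * (?C x * P x - w * ?S x * R x)) has_vector_derivative w * u t) (at t within {0..x})"
          if "t \<in> {0..x}" for t
          by (rule has_vector_derivative_within_subset[OF u1d]) (use that x in auto)
      qed (use x in simp)
      moreover have "P 0 = 0" by (simp add: P_def)
      moreover have "(h has_integral J x) {0..x}"
        unfolding J_def using integrable_on_prefix[OF h] x by (simp add: integrable_integral)
      ultimately have "((\<lambda>t. w * u t + h t) has_integral (w * (?C x * P x - w * ?S x * R x) + J x)) {0..x}"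
        by (auto dest: has_integral_add)
      then show ?thesis by (simp add: integral_unique u1_def)
    qed
    have bu: "norm (u x) \<le> K * N" if x: "x \<in> ?I" for x
    proof -
      have "norm (u x) \<le> norm (H x) + norm w * (norm (?S x) * norm (P x) + norm (?C x) * norm (R x))"
        unfolding u_def
        by (intro norm_triangle_mono order_refl)
           (auto simp: norm_mult intro!: mult_left_mono order_trans[OF norm_triangle_ineq4])
      also have "\<dots> \<le> N * l + norm w * (B * (Q * N) + B * (Q * N))"
        using B[OF x] H[OF x] P[OF x] R[OF x] \<open>0 \<le> B\<close> by (intro add_mono mult_left_mono mult_mono) auto
      also have "\<dots> = (l + norm w * (2 * B * Q)) * N" by (simp add: algebra_simps)
      also have "\<dots> \<le> K * N"
        using \<open>0 \<le> N\<close> \<open>0 \<le> B\<close> \<open>0 \<le> Q\<close> by (intro mult_right_mono) (auto simp: K_def)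
      finally show ?thesis .
    qed
    have bu1: "norm (u1 x) \<le> K * N" if x: "x \<in> ?I" for x
    proof -
      have "norm (u1 x) \<le> norm (J x) + norm w * (norm (?C x) * norm (P x) + norm w * norm (?S x) * norm (R x))"
        unfolding u1_def
        by (intro norm_triangle_mono order_refl)
           (auto simp: norm_mult intro!: mult_left_mono order_trans[OF norm_triangle_ineq4])
      also have "\<dots> \<le> N + norm w * (B * (Q * N) + norm w * B * (Q * N))"
        using B[OF x] J[OF x] P[OF x] R[OF x] \<open>0 \<le> B\<close>
        by (intro add_mono mult_left_mono mult_mono) auto
      also have "\<dots> = (1 + norm w * (B * Q + norm w * B * Q)) * N" by (simp add: algebra_simps)
      also have "\<dots> \<le> K * N"
        using \<open>0 \<le> N\<close> \<open>0 \<le> B\<close> \<open>0 \<le> Q\<close> l by (intro mult_right_mono) (auto simp: K_def)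
      finally show ?thesis .
    qed
    show "\<exists>u u1. u1 0 = 0 \<and>
      (\<forall>x\<in>?I. (u has_vector_derivative u1 x) (at x within ?I) \<and>
        u1 x = integral {0..x} (\<lambda>t. w * u t + h t) \<and>
        norm (u x) \<le> K * (LINT t|lebesgue_on ?I. norm (h t)) \<and>
        norm (u1 x) \<le> K * (LINT t|lebesgue_on ?I. norm (h t)))"
      using ud u1x bu bu1 unfolding N_def
      by (intro exI[of _ u] exI[of _ u1]) (auto simp: u_def u1_def H_def J_def P_def R_def)
  qed (rule \<open>0 \<le> K\<close>)
qed

section \<open>Determinantal description of the kernel dimension\<close>

text \<open>Up to sign, the determinants of these matrices are the minors of \<open>M\<close>.\<close>

definition replace_columns :: "complex^'n^'n \<Rightarrow> ('n \<Rightarrow> 'n option) \<Rightarrow> complex^'n^'n" where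
  "replace_columns M s = (\<chi> i j. case s j of None \<Rightarrow> M $ i $ j | Some r \<Rightarrow> if i = r then 1 else 0)"

lemma surj_matrix_iff_det_nz:
  fixes M :: "complex^'n^'n"
  shows "surj ((*v) M) \<longleftrightarrow> det M \<noteq> 0"
  by (simp add: invertible_det_nz[symmetric] invertible_right_inverse matrix_right_invertible_surjective)

lemma ker_matrix_iff_det_nz:
  fixes M :: "complex^'n^'n"
  shows "(\<forall>x. M *v x = 0 \<longrightarrow> x = 0) \<longleftrightarrow> det M \<noteq> 0"
  by (simp add: invertible_det_nz[symmetric] invertible_left_inverse matrix_left_invertible_ker)

lemma vec_dim_axis_image:
  "vec.independent ((\<lambda>i. axis i (1::complex)) ` (I :: 'n::finite set))" "card ((\<lambda>i. axis i (1::complex)) ` I) = card I"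
proof -
  have "(\<lambda>i. axis i (1::complex)) ` I \<subseteq> cart_basis" by (auto simp: cart_basis_def)
  then show "vec.independent ((\<lambda>i. axis i (1::complex)) ` I)"
    using independent_cart_basis vec.independent_mono by blast
  show "card ((\<lambda>i. axis i (1::complex)) ` I) = card I"
    by (intro card_image) (auto simp: inj_on_def axis_eq_axis)
qed

lemma matrix_vector_mult_axis:
  fixes A :: "complex^'n^'m"
  shows "A *v axis k 1 = column k A"
proof -
  have "(\<Sum>j\<in>UNIV. A $ i $ j * axis k 1 $ j) = (\<Sum>j\<in>UNIV. if j = k then A $ i $ j else 0)" for i
    by (intro sum.cong) (auto simp: axis_def)
  then show ?thesis by (simp add: matrix_vector_mult_def column_def)
qed

lemma subspace_kernel_matrix: "vec.subspace {x. (M :: complex^'n^'n) *v x = 0}"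
  by (auto simp: vec.subspace_def matrix_vector_right_distrib vector_scalar_commute)

text \<open>If the determinant were non-zero, a kernel vector of \<open>M\<close> would be
  determined by its coordinates at the replaced columns, since one vanishing there also lies in the
  kernel of the modified matrix. The kernel would then have dimension less than
  \<open>k\<close>.\<close>

lemma det_replace_columns_eq_0:
  fixes M :: "complex^'n^'n"
  assumes k: "k \<le> vec.dim {x. M *v x = 0}" and s: "card {j. s j \<noteq> None} < k"
  shows "det (replace_columns M s) = 0"
proof (rule ccontr)
  assume nz: "det (replace_columns M s) \<noteq> 0"
  let ?J = "{j. s j \<noteq> None}" and ?ker = "{x. M *v x = 0}"
  \<comment> \<open>The projection onto the coordinates of the replaced columns; it is shown to be
    injective on the kernel.\<close>
  define r :: "complex^'n \<Rightarrow> complex^'n" where "r = (\<lambda>x. \<chi> j. if j \<in> ?J then x $ j else 0)"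
  have lin: "Vector_Spaces.linear (*s) (*s) r"
    by (rule Vector_Spaces.linear_iff[THEN iffD2]) (auto simp: r_def vec_eq_iff vec.vector_space_axioms)
  have eq: "replace_columns M s *v x = M *v x" if "r x = 0" for x
  proof -
    have "x $ j = 0" if "s j \<noteq> None" for j
      using arg_cong[OF \<open>r x = 0\<close>, of "\<lambda>v. v $ j"] that by (simp add: r_def)
    then have "replace_columns M s $ i $ j * x $ j = M $ i $ j * x $ j" for i j
      by (cases "s j") (auto simp: replace_columns_def)
    then show ?thesis by (simp only: matrix_vector_mult_def)
  qed
  have "inj_on r (vec.span ?ker)"
    unfolding vec.span_eq_iff[THEN iffD2, OF subspace_kernel_matrix]
  proof (rule vec.linear_inj_on_iff_eq_0[OF lin subspace_kernel_matrix, THEN iffD2], intro ballI impI)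
    fix x assume "x \<in> ?ker" "r x = 0"
    then have "replace_columns M s *v x = 0" using eq by simp
    then show "x = 0" using nz ker_matrix_iff_det_nz by blast
  qed
  then have "vec.dim (r ` ?ker) = vec.dim ?ker" by (rule vec.dim_image_eq[OF lin])
  moreover have "r ` ?ker \<subseteq> vec.span ((\<lambda>i. axis i 1) ` ?J)"
  proof (rule image_subsetI)
    fix x
    have "r x = (\<Sum>j\<in>?J. x $ j *s axis j 1)"
      by (auto simp: r_def vec_eq_iff axis_def if_distrib sum.If_cases cong: if_cong)
    also have "\<dots> \<in> vec.span ((\<lambda>i. axis i 1) ` ?J)"
      by (intro vec.span_sum vec.span_scale vec.span_base) auto
    finally show "r x \<in> vec.span ((\<lambda>i. axis i 1) ` ?J)" .
  qed
  then have "vec.dim (r ` ?ker) \<le> card ((\<lambda>i. axis i (1::complex)) ` ?J)"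
    by (rule vec.dim_le_card) simp
  ultimately show False using k s vec_dim_axis_image(2)[of ?J] by linarith
qed

text \<open>
  The standard basis vectors \<open>e i\<close>, \<open>i \<in> I\<close>, complete the kernel to the whole space; the
  corresponding columns are then independent and are completed to a basis by standard basis vectors.
\<close>

lemma replace_columns_invertible:
  fixes M :: "complex^'n^'n"
  shows "\<exists>s. card {j. s j \<noteq> None} = vec.dim {x. M *v x = 0} \<and> det (replace_columns M s) \<noteq> 0"
proof -
  let ?ker = "{x. M *v x = 0}" and ?e = "\<lambda>i::'n. axis i (1::complex)"
  have cb: "card (cart_basis :: (complex^'n) set) = CARD('n)"
    by (metis vec_dim_card vec.dim_UNIV)
  \<comment> \<open>Exchange lemma: an independent set is completed to a basis by standard basis
    vectors outside it.\<close>
  have complete: "\<exists>I. (\<lambda>i. axis i 1) ` I \<inter> S = {} \<and> vec.independent (S \<union> ?e ` I) \<and> vec.span (S \<union> ?e ` I) = UNIV \<and>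
      card S + card I = CARD('n)" if S: "vec.independent S" for S :: "(complex^'n) set"
  proof -
    obtain B where B: "S \<subseteq> B" "B \<subseteq> S \<union> range ?e" "vec.independent B" "S \<union> range ?e \<subseteq> vec.span B"
      using vec.maximal_independent_subset_extend[of S "S \<union> range ?e"] S by auto
    define I where "I = {i. ?e i \<in> B - S}"
    have BI: "B = S \<union> ?e ` I" "?e ` I \<inter> S = {}" using B(1,2) by (auto simp: I_def)
    have "cart_basis \<subseteq> vec.span B" using B(4) by (auto simp: cart_basis_def)
    then have span: "vec.span B = UNIV"
      using vec.span_mono[of cart_basis "vec.span B"] by (simp add: span_cart_basis vec.span_span top.extremum_unique)
    have fin: "finite B" using B(3) by (rule vec.finiteI_independent)
    have "card B = vec.dim (UNIV :: (complex^'n) set)"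
      using vec.dim_span_eq_card_independent[OF B(3)] span by (simp)
    then have "card B = CARD('n)" by (simp add: cb)
    moreover have "card B = card S + card I"
      unfolding BI(1) using fin BI vec_dim_axis_image(2)[of I] by (subst card_Un_disjoint) (auto simp: Int_commute)
    ultimately show ?thesis using BI span B(3) by (intro exI[of _ I]) auto
  qed
  obtain K where K: "K \<subseteq> ?ker" "vec.independent K" "?ker \<subseteq> vec.span K" "card K = vec.dim ?ker"
    using vec.basis_exists[of ?ker] by blast
  have spanK: "vec.span K = ?ker"
    using K vec.span_minimal[OF K(1) subspace_kernel_matrix] by auto
  obtain I where I: "vec.independent (K \<union> ?e ` I)" "vec.span (K \<union> ?e ` I) = UNIV" "card K + card I = CARD('n)"
    using complete[OF K(2)] by blast
  let ?T = "vec.span (?e ` I)"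
  have "{x + y |x y. x \<in> ?ker \<and> y \<in> ?T} = UNIV"
    using I(2) by (simp add: vec.span_Un spanK)
  \<comment> \<open>The kernel and \<open>?T\<close> span the space and their dimensions add up to
    that of the space, so the sum is direct and \<open>M\<close> is injective on
    \<open>?T\<close>.\<close>
  then have "vec.dim (?ker \<inter> ?T) + CARD('n) = card K + card I"
    using vec.dim_sums_Int[OF subspace_kernel_matrix[of M] vec.subspace_span[of "?e ` I"]]
      vec.dim_span_eq_card_independent[OF vec_dim_axis_image(1)[of I]] vec_dim_axis_image(2)[of I] K(4)
    by (simp add: cb)
  then have "vec.dim (?ker \<inter> ?T) = 0" using I(3) by simp
  then have triv: "?ker \<inter> ?T \<subseteq> {0}" by simp
  have injT: "inj_on ((*v) M) ?T"
    using triv by (intro vec.linear_inj_on_iff_eq_0[OF matrix_vector_mul_linear_gen vec.subspace_span, THEN iffD2]) auto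
  define C where "C = (*v) M ` ?e ` I"
  have C: "vec.independent C"
    unfolding C_def by (rule vec.independent_injective_image[OF vec_dim_axis_image(1) injT])
  have cardC: "card C = card I"
    unfolding C_def using inj_on_subset[OF injT vec.span_superset] vec_dim_axis_image(2)[of I]
    by (simp add: card_image)
  obtain R where R: "vec.span (C \<union> ?e ` R) = UNIV" "card C + card R = CARD('n)"
    using complete[OF C] by blast
  \<comment> \<open>Counting matches the columns to be replaced with the standard basis vectors
    still missing; any bijection between them serves.\<close>
  have "card (- I) = card R"
    using R(2) cardC by (simp add: Compl_eq_Diff_UNIV card_Diff_subset)
  then obtain \<sigma> where \<sigma>: "bij_betw \<sigma> (- I) R"
    using finite_same_card_bij[OF finite finite] by blast
  define s where "s = (\<lambda>j. if j \<in> I then None else Some (\<sigma> j))"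
  have col: "replace_columns M s *v ?e j = (if j \<in> I then M *v ?e j else ?e (\<sigma> j))" for j
    unfolding matrix_vector_mult_axis
    by (auto simp: replace_columns_def s_def column_def axis_def vec_eq_iff)
  have "C \<union> ?e ` R \<subseteq> range ((*v) (replace_columns M s))"
  proof (intro Un_least subsetI)
    fix x assume "x \<in> C"
    then obtain i where "i \<in> I" "x = M *v ?e i" by (auto simp: C_def)
    then have "x = replace_columns M s *v ?e i" using col by simp
    then show "x \<in> range ((*v) (replace_columns M s))" by blast
  next
    fix x assume "x \<in> ?e ` R"
    then obtain j where "j \<notin> I" "x = ?e (\<sigma> j)" using \<sigma> by (auto simp: bij_betw_def)
    then have "x = replace_columns M s *v ?e j" using col by simp
    then show "x \<in> range ((*v) (replace_columns M s))" by blast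
  qed
  then have "vec.span (C \<union> ?e ` R) \<subseteq> range ((*v) (replace_columns M s))"
    by (rule vec.span_minimal) (rule vec.linear_subspace_image[OF matrix_vector_mul_linear_gen vec.subspace_UNIV])
  then have "det (replace_columns M s) \<noteq> 0"
    using R(1) surj_matrix_iff_det_nz by auto
  moreover have "{j. s j \<noteq> None} = - I" by (auto simp: s_def)
  moreover have "card (- I) = card K" using I(3) by (simp add: Compl_eq_Diff_UNIV card_Diff_subset)
  ultimately show ?thesis using K(4) by (intro exI[of _ s]) simp
qed

text \<open>This is the criterion that the rank is at most n - k iff all minors larger than n - k
  vanish, in the form of full-size determinants. For the converse, the pattern replacing exactly dim
  ker columns is the witness.\<close>

lemma kernel_dim_ge_iff:
  fixes M :: "complex^'n^'n"
  shows "k \<le> vec.dim {x. M *v x = 0} \<longleftrightarrow>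
    (\<forall>s. card {j. s j \<noteq> None} < k \<longrightarrow> det (replace_columns M s) = 0)"
  using det_replace_columns_eq_0[of k M] replace_columns_invertible[of M] by (metis not_le)

section \<open>Analytic functions on the parameter space\<close>

lemma analytic_fun_const: "analytic_fun M (\<lambda>p. c)"
  unfolding analytic_fun_def by (intro ballI exI[of _ "\<lambda>_. 0"]) auto

lemma analytic_fun_add:
  assumes "analytic_fun M f" "analytic_fun M g"
  shows "analytic_fun M (\<lambda>p. f p + g p)"
  unfolding analytic_fun_def
proof
  fix p assume "p \<in> M"
  then obtain D E where "(f has_derivative D) (at p within M)" "\<forall>c h. D (param_scale c h) = c * D h"
    "(g has_derivative E) (at p within M)" "\<forall>c h. E (param_scale c h) = c * E h"
    using assms unfolding analytic_fun_def by blast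
  then show "\<exists>D. ((\<lambda>p. f p + g p) has_derivative D) (at p within M) \<and> (\<forall>c h. D (param_scale c h) = c * D h)"
    by (intro exI[of _ "\<lambda>h. D h + E h"]) (auto intro: has_derivative_add simp: distrib_left)
qed

lemma analytic_fun_mult:
  assumes "analytic_fun M f" "analytic_fun M g"
  shows "analytic_fun M (\<lambda>p. f p * g p)"
  unfolding analytic_fun_def
proof
  fix p assume "p \<in> M"
  then obtain D E where "(f has_derivative D) (at p within M)" "\<forall>c h. D (param_scale c h) = c * D h"
    "(g has_derivative E) (at p within M)" "\<forall>c h. E (param_scale c h) = c * E h"
    using assms unfolding analytic_fun_def by blast
  then show "\<exists>D. ((\<lambda>p. f p * g p) has_derivative D) (at p within M) \<and> (\<forall>c h. D (param_scale c h) = c * D h)"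
    by (intro exI[of _ "\<lambda>h. f p * E h + D h * g p"] conjI has_derivative_mult) (auto simp: algebra_simps)
qed

lemma analytic_fun_sum:
  "(\<And>i. i \<in> I \<Longrightarrow> analytic_fun M (f i)) \<Longrightarrow> analytic_fun M (\<lambda>p. \<Sum>i\<in>I. f i p)"
  by (induction I rule: infinite_finite_induct) (auto intro: analytic_fun_const analytic_fun_add)

lemma analytic_fun_prod:
  "(\<And>i. i \<in> I \<Longrightarrow> analytic_fun M (f i)) \<Longrightarrow> analytic_fun M (\<lambda>p. \<Prod>i\<in>I. f i p)"
  by (induction I rule: infinite_finite_induct) (auto intro: analytic_fun_const analytic_fun_mult)

lemma analytic_fun_compose:
  assumes f: "analytic_fun M f" and g: "\<And>w. \<exists>d. (g has_field_derivative d) (at w)"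
  shows "analytic_fun M (\<lambda>p. g (f p))"
  unfolding analytic_fun_def
proof
  fix p assume "p \<in> M"
  then obtain D where D: "(f has_derivative D) (at p within M)" "\<forall>c h. D (param_scale c h) = c * D h"
    using f unfolding analytic_fun_def by blast
  obtain d where "(g has_derivative (*) d) (at (f p))"
    using g by (auto simp: has_field_derivative_def)
  from has_derivative_compose[OF D(1) this] D(2)
  show "\<exists>D. ((\<lambda>p. g (f p)) has_derivative D) (at p within M) \<and> (\<forall>c h. D (param_scale c h) = c * D h)"
    by (intro exI[of _ "\<lambda>h. d * D h"]) (auto simp: mult_ac)
qed

lemma analytic_fun_linear:
  assumes "bounded_linear f" "\<And>c h. f (param_scale c h) = c * f h"
  shows "analytic_fun M f"
  unfolding analytic_fun_def using assms bounded_linear_imp_has_derivative by blast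

lemma analytic_fun_coords:
  "analytic_fun M (\<lambda>p. fst p $ v $ h $ h')"
  "analytic_fun M (\<lambda>p. fst (snd p) $ v $ h $ h')"
  "analytic_fun M (\<lambda>p. fst (snd (snd p)) $ e)"
  "analytic_fun M (\<lambda>p. snd (snd (snd p)))"
proof -
  note bl = bounded_linear_compose[OF bounded_linear_vec_nth] bounded_linear_compose[OF bounded_linear_fst]
    bounded_linear_compose[OF bounded_linear_snd] bounded_linear_ident
  show "analytic_fun M (\<lambda>p. fst p $ v $ h $ h')"
    by (rule analytic_fun_linear, intro bl) (simp only: split_paired_all param_scale.simps fst_conv snd_conv vec_lambda_beta vector_smult_component)
  show "analytic_fun M (\<lambda>p. fst (snd p) $ v $ h $ h')"
    by (rule analytic_fun_linear, intro bl) (simp only: split_paired_all param_scale.simps fst_conv snd_conv vec_lambda_beta vector_smult_component)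
  show "analytic_fun M (\<lambda>p. fst (snd (snd p)) $ e)"
    by (rule analytic_fun_linear, intro bl) (simp only: split_paired_all param_scale.simps fst_conv snd_conv vec_lambda_beta vector_smult_component)
  show "analytic_fun M (\<lambda>p. snd (snd (snd p)))"
    by (rule analytic_fun_linear, intro bl) (simp only: split_paired_all param_scale.simps fst_conv snd_conv vec_lambda_beta vector_smult_component)
qed

lemma analytic_fun_det:
  assumes "\<And>i j. analytic_fun M (\<lambda>p. F p $ i $ j)"
  shows "analytic_fun M (\<lambda>p. det (F p))"
  unfolding det_def
  by (intro analytic_fun_sum analytic_fun_mult analytic_fun_const analytic_fun_prod assms)

lemma analytic_fun_continuous_on:
  assumes "analytic_fun M f" shows "continuous_on M f"
  using assms has_derivative_continuous unfolding analytic_fun_def continuous_on_eq_continuous_within by blast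

text \<open>The defining functions are global, so \<open>M\<close> itself serves as the
  neighbourhood of every point, and closedness comes from continuity.\<close>

lemma analytic_subset_zeros:
  assumes F: "finite F" "\<And>f. f \<in> F \<Longrightarrow> analytic_fun M f" and S: "S = {p \<in> M. \<forall>f\<in>F. f p = 0}"
  shows "analytic_subset M S"
  unfolding analytic_subset_def
proof (intro conjI ballI)
  have cl: "closedin (top_of_set M) {p \<in> M. f p = 0}" if "f \<in> F" for f
    by (rule continuous_closedin_preimage_constant[OF analytic_fun_continuous_on[OF F(2)[OF that]]])
  \<comment> \<open>Intersecting with \<open>M\<close> also covers an empty \<open>F\<close>, for
    which the inner intersection is everything.\<close>
  have "closedin (top_of_set M) (M \<inter> (\<Inter>f\<in>F. {p \<in> M. f p = 0}))"
  proof (cases "F = {}")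
    case False
    then show ?thesis using cl by (intro closedin_Int closedin_INT) auto
  qed auto
  moreover have "S = M \<inter> (\<Inter>f\<in>F. {p \<in> M. f p = 0})" using S by auto
  ultimately show "closedin (top_of_set M) S" by simp
  show "\<exists>N F. openin (top_of_set M) N \<and> p \<in> N \<and> finite F \<and> (\<forall>f\<in>F. analytic_fun N f) \<and>
      S \<inter> N = {x \<in> N. \<forall>f\<in>F. f x = 0}" if "p \<in> M" for p
    using that F S by (intro exI[of _ M] exI[of _ F]) auto
qed

section \<open>Comparison of integral, supremum and square norms\<close>

text \<open>Cauchy-Schwarz against the constant 1, obtained from the non-negativity of the variance
  of |g|.\<close>

lemma LINT_norm_le_sqrt:
  assumes g: "g \<in> L2_interval l" and l: "0 < l"
  shows "(LINT x|lebesgue_on {0..l}. norm (g x)) \<le> sqrt (l * (LINT x|lebesgue_on {0..l}. (norm (g x))\<^sup>2))"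
proof -
  let ?M = "lebesgue_on {0..l}"
  define m where "m = (LINT x|?M. norm (g x))"
  define q where "q = (LINT x|?M. (norm (g x))\<^sup>2)"
  have i1: "integrable ?M (\<lambda>x. norm (g x))" using L2_interval_integrable[OF g] by simp
  have i2: "integrable ?M (\<lambda>x. (norm (g x))\<^sup>2)" using g by (simp add: L2_interval_def)
  have len: "measure ?M {0..l} = l" using l by (simp add: measure_restrict_space)
  have "0 \<le> (LINT x|?M. (norm (g x) - m / l)\<^sup>2)" by simp
  also have "\<dots> = (LINT x|?M. (norm (g x))\<^sup>2 + (- 2 * (m / l)) * norm (g x) + (m / l)\<^sup>2)"
    by (simp add: power2_diff algebra_simps)
  also have "\<dots> = q + (- 2 * (m / l)) * m + (m / l)\<^sup>2 * l"
    using i1 i2 by (simp add: q_def m_def len)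
  also have "\<dots> = q - m\<^sup>2 / l" using l by (simp add: power2_eq_square field_simps)
  finally have "m\<^sup>2 \<le> l * q" using l by (simp add: field_simps)
  then show ?thesis unfolding m_def[symmetric] q_def[symmetric] by (rule real_le_rsqrt)
qed

lemma LINT_norm_le_L2_norm:
  assumes "g \<in> L2 G" "0 < edge_length G e"
  shows "(LINT x|lebesgue_on {0..edge_length G e}. norm (g e x)) \<le> sqrt (edge_length G e) * L2_norm G g"
proof -
  have "(LINT x|lebesgue_on {0..edge_length G e}. (norm (g e x))\<^sup>2)
      \<le> (\<Sum>e\<in>UNIV. LINT x|lebesgue_on {0..edge_length G e}. (norm (g e x))\<^sup>2)"
    by (rule member_le_sum) auto
  then have "sqrt (edge_length G e * (LINT x|lebesgue_on {0..edge_length G e}. (norm (g e x))\<^sup>2))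
      \<le> sqrt (edge_length G e) * L2_norm G g"
    unfolding L2_norm_def real_sqrt_mult[symmetric] using assms(2) by (simp add: mult_left_mono)
  moreover have "g e \<in> L2_interval (edge_length G e)" using assms(1) by (simp add: L2_def)
  ultimately show ?thesis using LINT_norm_le_sqrt assms(2) order_trans by blast
qed

lemma L2_norm_le_bound:
  assumes L: "f \<in> L2 G" and l: "\<And>e. 0 < edge_length G e"
    and b: "\<And>e x. x \<in> {0..edge_length G e} \<Longrightarrow> norm (f e x) \<le> b" "0 \<le> b"
  shows "L2_norm G f \<le> sqrt (\<Sum>e\<in>UNIV. edge_length G e) * b"
proof -
  have "(LINT x|lebesgue_on {0..edge_length G e}. (norm (f e x))\<^sup>2) \<le> edge_length G e * b\<^sup>2" for e
  proof -
    let ?M = "lebesgue_on {0..edge_length G e}"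
    have "(LINT x|?M. (norm (f e x))\<^sup>2) \<le> (LINT x|?M. b\<^sup>2)"
      by (rule integral_mono) (use L b(1)[of _ e] in \<open>auto simp: L2_def L2_interval_def intro!: power_mono\<close>)
    moreover have "measure ?M {0..edge_length G e} = edge_length G e"
      using l[of e] by (simp add: measure_restrict_space)
    ultimately show ?thesis by simp
  qed
  then have "L2_norm G f \<le> sqrt (\<Sum>e\<in>UNIV. edge_length G e * b\<^sup>2)"
    unfolding L2_norm_def by (intro real_sqrt_le_mono sum_mono)
  also have "\<dots> = sqrt (\<Sum>e\<in>UNIV. edge_length G e) * b"
    using b(2) by (simp add: sum_distrib_right[symmetric] real_sqrt_mult)
  finally show ?thesis .
qed

section \<open>Boundary value problems on the graph\<close>

definition edge_w :: "complex ^ 'e \<Rightarrow> complex \<Rightarrow> 'e \<Rightarrow> complex" where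
  "edge_w \<xi> z e = - z * (\<xi> $ e)\<^sup>2"

text \<open>
  The equation \<open>-\<xi>\<^sup>-\<^sup>2 f'' - z f = g\<close> in integrated form; \<open>F\<close> is the derivative of \<open>f\<close>.
\<close>

definition solves :: "('v, 'e::finite) metric_graph \<Rightarrow> complex ^ 'e \<Rightarrow> complex \<Rightarrow>
    ('e \<Rightarrow> real \<Rightarrow> complex) \<Rightarrow> ('e \<Rightarrow> real \<Rightarrow> complex) \<Rightarrow> ('e \<Rightarrow> real \<Rightarrow> complex) \<Rightarrow> bool" where
  "solves G \<xi> z g f F \<longleftrightarrow> (\<forall>e. (\<forall>x. x \<notin> {0..edge_length G e} \<longrightarrow> f e x = 0) \<and>
     (\<forall>x\<in>{0..edge_length G e}. (f e has_vector_derivative F e x) (at x within {0..edge_length G e}) \<and>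
       F e x = F e 0 + integral {0..x} (\<lambda>t. edge_w \<xi> z e * f e t - (\<xi> $ e)\<^sup>2 * g e t)))"

lemma solvesD:
  assumes "solves G \<xi> z g f F"
  shows "x \<notin> {0..edge_length G e} \<Longrightarrow> f e x = 0"
    "x \<in> {0..edge_length G e} \<Longrightarrow> (f e has_vector_derivative F e x) (at x within {0..edge_length G e})"
    "x \<in> {0..edge_length G e} \<Longrightarrow> F e x = F e 0 + integral {0..x} (\<lambda>t. edge_w \<xi> z e * f e t - (\<xi> $ e)\<^sup>2 * g e t)"
proof -
  note a = assms[unfolded solves_def, THEN spec[of _ e]]
  show "x \<notin> {0..edge_length G e} \<Longrightarrow> f e x = 0" using a[THEN conjunct1] by blast
  assume x: "x \<in> {0..edge_length G e}"
  note b = bspec[OF a[THEN conjunct2] x]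
  show "(f e has_vector_derivative F e x) (at x within {0..edge_length G e})" by (rule b[THEN conjunct1])
  show "F e x = F e 0 + integral {0..x} (\<lambda>t. edge_w \<xi> z e * f e t - (\<xi> $ e)\<^sup>2 * g e t)" by (rule b[THEN conjunct2])
qed

lemma L2_interval_add:
  assumes "f \<in> L2_interval l" "g \<in> L2_interval l"
  shows "(\<lambda>x. f x + g x) \<in> L2_interval l"
proof -
  have m: "f \<in> borel_measurable (lebesgue_on {0..l})" "g \<in> borel_measurable (lebesgue_on {0..l})"
    and i: "integrable (lebesgue_on {0..l}) (\<lambda>x. 2 * (norm (f x))\<^sup>2 + 2 * (norm (g x))\<^sup>2)"
    using assms by (auto simp: L2_interval_def)
  have "(norm (f x + g x))\<^sup>2 \<le> 2 * (norm (f x))\<^sup>2 + 2 * (norm (g x))\<^sup>2" for x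
  proof -
    have "(norm (f x + g x))\<^sup>2 \<le> (norm (f x) + norm (g x))\<^sup>2"
      by (intro power_mono norm_triangle_ineq) auto
    also have "\<dots> \<le> 2 * (norm (f x))\<^sup>2 + 2 * (norm (g x))\<^sup>2"
      using zero_le_power2[of "norm (f x) - norm (g x)"] by (simp add: power2_eq_square algebra_simps)
    finally show ?thesis .
  qed
  then have le: "AE x in lebesgue_on {0..l}. norm ((norm (f x + g x))\<^sup>2) \<le> norm (2 * (norm (f x))\<^sup>2 + 2 * (norm (g x))\<^sup>2)"
    by simp
  have "(\<lambda>x. (norm (f x + g x))\<^sup>2) \<in> borel_measurable (lebesgue_on {0..l})"
    using m by measurable
  then have "integrable (lebesgue_on {0..l}) (\<lambda>x. (norm (f x + g x))\<^sup>2)"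
    using le by (rule Bochner_Integration.integrable_bound[OF i])
  then show ?thesis using m by (simp add: L2_interval_def)
qed

lemma L2_interval_cmult:
  assumes "f \<in> L2_interval l"
  shows "(\<lambda>x. c * f x) \<in> L2_interval l"
  using assms by (auto simp: L2_interval_def norm_mult power_mult_distrib)

lemma H2_graph_solves:
  assumes f: "f \<in> H2_graph G" and eq: "L2_eq G (H_minus G \<xi> z f) g" and g: "g \<in> L2 G"
    and l: "\<And>e. 0 < edge_length G e" and \<xi>: "\<And>e. \<xi> $ e \<noteq> 0"
  obtains F where "solves G \<xi> z g f F"
proof -
  have "\<exists>F. \<forall>x\<in>{0..edge_length G e}. (f e has_vector_derivative F x) (at x within {0..edge_length G e}) \<and>
       F x = F 0 + integral {0..x} (\<lambda>t. edge_w \<xi> z e * f e t - (\<xi> $ e)\<^sup>2 * g e t)" for e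
  proof -
    let ?l = "edge_length G e"
    let ?k = "\<lambda>t. edge_w \<xi> z e * f e t - (\<xi> $ e)\<^sup>2 * g e t"
    have fe: "f e \<in> H2_interval ?l" "continuous_on {0..?l} (f e)" using f by (auto simp: H2_graph_def)
    obtain F h where F: "h \<in> L2_interval ?l"
      "\<And>x. x \<in> {0..?l} \<Longrightarrow> (f e has_vector_derivative F x) (at x within {0..?l})"
      "\<And>x. x \<in> {0..?l} \<Longrightarrow> F x = F 0 + integral {0..x} h"
      "AE x in lebesgue_on {0..?l}. weak_deriv ?l (weak_deriv ?l (f e)) x = h x"
      by (rule H2_intervalD[OF fe l]) (rule that)
    have ki: "integrable (lebesgue_on {0..?l}) ?k"
      using continuous_imp_integrable_real[OF fe(2)] L2_interval_integrable[of "g e" ?l] g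
      by (auto simp: L2_def)
    have "AE x in lebesgue_on {0..?l}. H_minus G \<xi> z f e x = g e x" using eq by (simp add: L2_eq_def)
    with F(4) have "AE x in lebesgue_on {0..?l}. h x = ?k x"
    proof eventually_elim
      case (elim x)
      then have "- (1 / (\<xi> $ e)\<^sup>2) * h x = g e x + z * f e x" by (simp add: H_minus_def H_op_def diff_eq_eq)
      \<comment> \<open>Multiplying the equation back by -\<xi>^2, possible since \<xi> is
        non-zero.\<close>
      moreover have "h x = - (\<xi> $ e)\<^sup>2 * (- (1 / (\<xi> $ e)\<^sup>2) * h x)" using \<xi>[of e] by simp
      ultimately have "h x = - (\<xi> $ e)\<^sup>2 * (g e x + z * f e x)" by argo
      also have "\<dots> = edge_w \<xi> z e * f e x - (\<xi> $ e)\<^sup>2 * g e x" by (simp add: edge_w_def algebra_simps)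
      finally show ?case .
    qed
    then have k: "integral {0..x} h = integral {0..x} ?k" if "x \<in> {0..?l}" for x
      by (rule primitive_cong_AE[OF L2_interval_integrable[OF F(1)] ki _ that])
    have "F x = F 0 + integral {0..x} ?k" if "x \<in> {0..?l}" for x
      using F(3)[OF that] unfolding k[OF that] .
    then show ?thesis using F(2) by blast
  qed
  from choice[OF allI[OF this]] obtain F where F: "\<forall>e. \<forall>x\<in>{0..edge_length G e}.
      (f e has_vector_derivative F e x) (at x within {0..edge_length G e}) \<and>
       F e x = F e 0 + integral {0..x} (\<lambda>t. edge_w \<xi> z e * f e t - (\<xi> $ e)\<^sup>2 * g e t)"
    by (rule exE)
  have z: "\<forall>e. \<forall>x. x \<notin> {0..edge_length G e} \<longrightarrow> f e x = 0" using f unfolding H2_graph_def by blast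
  have "solves G \<xi> z g f F" unfolding solves_def
  proof (rule allI, rule conjI)
    fix e
    show "\<forall>x. x \<notin> {0..edge_length G e} \<longrightarrow> f e x = 0" using z by (rule spec)
    show "\<forall>x\<in>{0..edge_length G e}. (f e has_vector_derivative F e x) (at x within {0..edge_length G e}) \<and>
       F e x = F e 0 + integral {0..x} (\<lambda>t. edge_w \<xi> z e * f e t - (\<xi> $ e)\<^sup>2 * g e t)" using F by (rule spec)
  qed
  then show ?thesis by (rule that)
qed

lemma solves_continuous:
  assumes "solves G \<xi> z g f F" shows "continuous_on {0..edge_length G e} (f e)"
  using solvesD(2)[OF assms] by (rule continuous_on_vector_derivative)

lemma solves_H2_graph:
  assumes s: "solves G \<xi> z g f F" and g: "g \<in> L2 G"
    and l: "\<And>e. 0 < edge_length G e" and \<xi>: "\<And>e. \<xi> $ e \<noteq> 0"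
  shows "f \<in> H2_graph G" "L2_eq G (H_minus G \<xi> z f) g"
proof -
  have h: "(\<lambda>t. edge_w \<xi> z e * f e t - (\<xi> $ e)\<^sup>2 * g e t) \<in> L2_interval (edge_length G e)" for e
    using L2_interval_add[OF L2_interval_cmult[OF L2_interval_continuous[OF solves_continuous[OF s]]]
        L2_interval_cmult[of "g e", where c = "- (\<xi> $ e)\<^sup>2"]] g by (simp add: L2_def)
  have H: "f e \<in> H2_interval (edge_length G e)" "continuous_on {0..edge_length G e} (f e)"
    "AE x in lebesgue_on {0..edge_length G e}. weak_deriv (edge_length G e) (weak_deriv (edge_length G e) (f e)) x =
      edge_w \<xi> z e * f e x - (\<xi> $ e)\<^sup>2 * g e x" for e
    by ((rule H2_intervalI[OF h l solvesD(2)[OF s] solvesD(3)[OF s]]; assumption)+)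
  show "f \<in> H2_graph G" using H(1,2) solvesD(1)[OF s] by (simp add: H2_graph_def)
  show "L2_eq G (H_minus G \<xi> z f) g"
    unfolding L2_eq_def
  proof
    fix e
    show "AE x in lebesgue_on {0..edge_length G e}. H_minus G \<xi> z f e x = g e x"
      using H(3)[of e]
    proof eventually_elim
      case (elim x)
      have "- (1 / (\<xi> $ e)\<^sup>2) * (edge_w \<xi> z e * f e x - (\<xi> $ e)\<^sup>2 * g e x) - z * f e x = g e x"
        using \<xi>[of e] by (simp add: edge_w_def field_simps)
      then show ?case by (simp only: H_minus_def H_op_def elim)
    qed
  qed
qed

text \<open>Used with a = 1 to correct a particular solution by a homogeneous one, and with a = -1
  for uniqueness.\<close>

lemma solves_combine:
  assumes s: "solves G \<xi> z g f F" "solves G \<xi> z g' f' F'" and g: "g \<in> L2 G" "g' \<in> L2 G"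
  shows "solves G \<xi> z (\<lambda>e x. g e x + a * g' e x) (\<lambda>e x. f e x + a * f' e x) (\<lambda>e x. F e x + a * F' e x)"
  unfolding solves_def
proof (intro allI conjI impI ballI)
  fix e x
  let ?l = "edge_length G e"
  show "f e x + a * f' e x = 0" if "x \<notin> {0..?l}" using solvesD(1)[OF s(1) that] solvesD(1)[OF s(2) that] by simp
  assume x: "x \<in> {0..?l}"
  show "((\<lambda>x. f e x + a * f' e x) has_vector_derivative F e x + a * F' e x) (at x within {0..?l})"
    using solvesD(2)[OF s(1) x] solvesD(2)[OF s(2) x] by (auto intro!: derivative_eq_intros)
  let ?k = "\<lambda>t. edge_w \<xi> z e * f e t - (\<xi> $ e)\<^sup>2 * g e t" and ?k' = "\<lambda>t. edge_w \<xi> z e * f' e t - (\<xi> $ e)\<^sup>2 * g' e t"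
  have i: "integrable (lebesgue_on {0..?l}) ?k" "integrable (lebesgue_on {0..?l}) ?k'"
    using continuous_imp_integrable_real[OF solves_continuous[OF s(1)]]
      continuous_imp_integrable_real[OF solves_continuous[OF s(2)]]
      L2_interval_integrable[of "g e" ?l] L2_interval_integrable[of "g' e" ?l] g by (auto simp: L2_def)
  have "integral {0..x} (\<lambda>t. ?k t + a * ?k' t) = integral {0..x} ?k + integral {0..x} (\<lambda>t. a * ?k' t)"
    using integrable_on_prefix[OF i(1)] integrable_on_prefix[OF i(2)] x
    by (intro Henstock_Kurzweil_Integration.integral_add integrable_on_mult_right) auto
  also have "\<dots> = integral {0..x} ?k + a * integral {0..x} ?k'" by simp
  finally have "integral {0..x} (\<lambda>t. edge_w \<xi> z e * (f e t + a * f' e t) - (\<xi> $ e)\<^sup>2 * (g e t + a * g' e t)) =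
      integral {0..x} ?k + a * integral {0..x} ?k'"
    by (simp add: algebra_simps)
  then show "F e x + a * F' e x = F e 0 + a * F' e 0 +
      integral {0..x} (\<lambda>t. edge_w \<xi> z e * (f e t + a * f' e t) - (\<xi> $ e)\<^sup>2 * (g e t + a * g' e t))"
    using solvesD(3)[OF s(1) x] solvesD(3)[OF s(2) x] by (simp add: algebra_simps)
qed

definition end_values :: "('v, 'e::finite) metric_graph \<Rightarrow> ('e \<Rightarrow> real \<Rightarrow> complex) \<Rightarrow> 'e end_vec" where
  "end_values G f = (\<chi> h. f (fst h) (if snd h then edge_length G (fst h) else 0))"

text \<open>\<open>F\<close> is the derivative function supplied by \<open>solves\<close>; the sign
  at the far end turns it into the derivative directed into the edge.\<close>

definition end_derivs :: "('v, 'e::finite) metric_graph \<Rightarrow> ('e \<Rightarrow> real \<Rightarrow> complex) \<Rightarrow> 'e end_vec" where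
  "end_derivs G F = (\<chi> h. if snd h then - F (fst h) (edge_length G (fst h)) else F (fst h) 0)"

lemma end_value_eq: "end_value G f h = end_values G f $ h"
  by (cases h; cases "snd h") (auto simp: end_values_def)

lemma end_deriv_eq:
  assumes "solves G \<xi> z g f F" "\<And>e. 0 < edge_length G e"
  shows "end_deriv G f h = end_derivs G F $ h"
proof (cases h)
  case (Pair e b)
  have "vector_derivative (f e) (at x within {0..edge_length G e}) = F e x" if "x \<in> {0..edge_length G e}" for x
    using solvesD(2)[OF assms(1) that] assms(2)[of e] that
    by (intro vector_derivative_within_closed_interval) auto
  from this[of 0] this[of "edge_length G e"] show ?thesis
    using Pair assms(2)[of e] by (cases b) (auto simp: end_derivs_def)
qed

text \<open>Each edge-end belongs to exactly one vertex, so taking row \<open>h\<close> from the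
  matrix of that vertex assembles the block-diagonal matrix of all A_v. Likewise
  \<open>deriv_matrix\<close> is the block-diagonal matrix of the B_v times the diagonal matrix of
  \<xi>.\<close>

definition value_matrix :: "('v, 'e::finite) metric_graph \<Rightarrow> 'e end_mat ^ 'v \<Rightarrow> 'e end_mat" where
  "value_matrix G A = (\<chi> h h'. A $ end_vertex G h $ h $ h')"

definition deriv_matrix :: "('v, 'e::finite) metric_graph \<Rightarrow> 'e end_mat ^ 'v \<Rightarrow> complex ^ 'e \<Rightarrow> 'e end_mat" where
  "deriv_matrix G B \<xi> = (\<chi> h h'. B $ end_vertex G h $ h $ h' * \<xi> $ fst h')"

text \<open>In the padded condition at \<open>v\<close> every row belonging to an edge-end elsewhere
  reads 0 = 0. What remains is one scalar equation per edge-end, at its own vertex.\<close>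

lemma H_dom_iff:
  assumes sup: "supported G A" "supported G B"
    and s: "solves G \<xi> z g f F" and f: "f \<in> H2_graph G" and l: "\<And>e. 0 < edge_length G e"
  shows "f \<in> H_dom G A B \<xi> \<longleftrightarrow> value_matrix G A *v end_values G f + deriv_matrix G B \<xi> *v end_derivs G F = 0"
proof -
  let ?row = "\<lambda>v. A $ v *v vertex_values G f v + B $ v *v (Xi G \<xi> v *v vertex_derivs G f v)"
  have A0: "A $ v $ h $ h' = 0" "B $ v $ h $ h' = 0" if "h \<notin> ends_at G v \<or> h' \<notin> ends_at G v" for v h h'
    using sup that unfolding supported_def by blast+
  have Xi: "(Xi G \<xi> v *v vertex_derivs G f v) $ h = (if h \<in> ends_at G v then \<xi> $ fst h * end_derivs G F $ h else 0)" for v h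
  proof -
    have "(\<Sum>h'\<in>UNIV. Xi G \<xi> v $ h $ h' * vertex_derivs G f v $ h') =
        (\<Sum>h'\<in>UNIV. if h' = h then (if h \<in> ends_at G v then \<xi> $ fst h * end_derivs G F $ h else 0) else 0)"
      by (intro sum.cong) (auto simp: Xi_def vertex_derivs_def end_deriv_eq[OF s l])
    then show ?thesis by (simp add: matrix_vector_mult_def)
  qed
  have row: "?row v $ h = (\<Sum>h'\<in>UNIV. A $ v $ h $ h' * end_values G f $ h') +
      (\<Sum>h'\<in>UNIV. B $ v $ h $ h' * \<xi> $ fst h' * end_derivs G F $ h')" for v h
  proof -
    have "A $ v $ h $ h' * vertex_values G f v $ h' = A $ v $ h $ h' * end_values G f $ h'"
      "B $ v $ h $ h' * (Xi G \<xi> v *v vertex_derivs G f v) $ h' = B $ v $ h $ h' * \<xi> $ fst h' * end_derivs G F $ h'" for h'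
      using A0[of h v h'] by (auto simp: vertex_values_def end_value_eq Xi)
    then show ?thesis by (simp only: matrix_vector_mult_def vector_add_component vec_lambda_beta)
  qed
  have off: "?row v $ h = 0" if "end_vertex G h \<noteq> v" for v h
  proof -
    have "h \<notin> ends_at G v" using that by (simp add: ends_at_def)
    then show ?thesis unfolding row using A0[of h v] by simp
  qed
  have "f \<in> H_dom G A B \<xi> \<longleftrightarrow> (\<forall>v. ?row v = 0)" using f by (simp add: H_dom_def)
  also have "\<dots> \<longleftrightarrow> (\<forall>v h. ?row v $ h = 0)" by (simp add: vec_eq_iff)
  also have "\<dots> \<longleftrightarrow> (\<forall>h. ?row (end_vertex G h) $ h = 0)"
  proof (intro iffI allI)
    fix v h assume a: "\<forall>h. ?row (end_vertex G h) $ h = 0"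
    show "?row v $ h = 0"
    proof (cases "end_vertex G h = v")
      case True
      show ?thesis using spec[OF a, of h] unfolding True .
    qed (rule off)
  qed blast
  also have "\<dots> \<longleftrightarrow> value_matrix G A *v end_values G f + deriv_matrix G B \<xi> *v end_derivs G F = 0"
    unfolding row by (simp add: vec_eq_iff matrix_vector_mult_def value_matrix_def deriv_matrix_def)
  finally show ?thesis .
qed

text \<open>
  Solutions of the homogeneous equation are parametrised by their Cauchy data at coordinate \<open>0\<close>:
  \<open>c $ (e, False)\<close> is the value and \<open>c $ (e, True)\<close> the derivative of the solution at \<open>0\<close> on \<open>e\<close>.
\<close>

definition hom_sol :: "('v, 'e::finite) metric_graph \<Rightarrow> complex ^ 'e \<Rightarrow> complex \<Rightarrow> 'e end_vec \<Rightarrow> 'e \<Rightarrow> real \<Rightarrow> complex" where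
  "hom_sol G \<xi> z c = (\<lambda>e x. if x \<in> {0..edge_length G e}
     then c $ (e, False) * ode_cos (edge_w \<xi> z e) x + c $ (e, True) * ode_sin (edge_w \<xi> z e) x else 0)"

definition hom_sol_deriv :: "complex ^ 'e::finite \<Rightarrow> complex \<Rightarrow> 'e end_vec \<Rightarrow> 'e \<Rightarrow> real \<Rightarrow> complex" where
  "hom_sol_deriv \<xi> z c = (\<lambda>e x. c $ (e, False) * (edge_w \<xi> z e * ode_sin (edge_w \<xi> z e) x) +
     c $ (e, True) * ode_cos (edge_w \<xi> z e) x)"

lemma has_vector_derivative_ode_combination:
  "((\<lambda>x. a * ode_cos w x + b * ode_sin w x) has_vector_derivative a * (w * ode_sin w x) + b * ode_cos w x) (at x within S)"
  "((\<lambda>x. a * (w * ode_sin w x) + b * ode_cos w x) has_vector_derivative w * (a * ode_cos w x + b * ode_sin w x)) (at x within S)"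
proof -
  show "((\<lambda>x. a * ode_cos w x + b * ode_sin w x) has_vector_derivative a * (w * ode_sin w x) + b * ode_cos w x) (at x within S)"
    by (intro has_vector_derivative_add has_vector_derivative_mult_right has_vector_derivative_ode_cos has_vector_derivative_ode_sin)
  have "((\<lambda>x. a * (w * ode_sin w x) + b * ode_cos w x) has_vector_derivative a * (w * ode_cos w x) + b * (w * ode_sin w x)) (at x within S)"
    by (intro has_vector_derivative_add has_vector_derivative_mult_right has_vector_derivative_ode_cos has_vector_derivative_ode_sin)
  then show "((\<lambda>x. a * (w * ode_sin w x) + b * ode_cos w x) has_vector_derivative w * (a * ode_cos w x + b * ode_sin w x)) (at x within S)"
    by (simp add: algebra_simps)
qed

lemma hom_sol_solves: "solves G \<xi> z (\<lambda>_ _. 0) (hom_sol G \<xi> z c) (hom_sol_deriv \<xi> z c)"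
  unfolding solves_def
proof (intro allI conjI impI ballI)
  fix e x
  let ?l = "edge_length G e" and ?w = "edge_w \<xi> z e"
  let ?f = "\<lambda>x. c $ (e, False) * ode_cos ?w x + c $ (e, True) * ode_sin ?w x"
  show "hom_sol G \<xi> z c e x = 0" if "x \<notin> {0..?l}" using that by (simp only: hom_sol_def if_False)
  assume x: "x \<in> {0..?l}"
  have "(?f has_vector_derivative hom_sol_deriv \<xi> z c e x) (at x within {0..?l})"
    unfolding hom_sol_deriv_def by (rule has_vector_derivative_ode_combination)
  then show "(hom_sol G \<xi> z c e has_vector_derivative hom_sol_deriv \<xi> z c e x) (at x within {0..?l})"
    by (rule has_vector_derivative_transform[OF x, rotated]) (simp add: hom_sol_def)
  have "((\<lambda>t. ?w * ?f t) has_integral hom_sol_deriv \<xi> z c e x - hom_sol_deriv \<xi> z c e 0) {0..x}"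
    unfolding hom_sol_deriv_def
    by (rule fundamental_theorem_of_calculus) (use x in \<open>simp, intro has_vector_derivative_ode_combination\<close>)
  then have "integral {0..x} (\<lambda>t. ?w * ?f t) = hom_sol_deriv \<xi> z c e x - hom_sol_deriv \<xi> z c e 0"
    by (rule integral_unique)
  moreover have "integral {0..x} (\<lambda>t. ?w * hom_sol G \<xi> z c e t - (\<xi> $ e)\<^sup>2 * 0) = integral {0..x} (\<lambda>t. ?w * ?f t)"
    using x by (intro Henstock_Kurzweil_Integration.integral_cong) (auto simp: hom_sol_def)
  ultimately show "hom_sol_deriv \<xi> z c e x = hom_sol_deriv \<xi> z c e 0 +
      integral {0..x} (\<lambda>t. ?w * hom_sol G \<xi> z c e t - (\<xi> $ e)\<^sup>2 * 0)" by simp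
qed

text \<open>Without a source term the integrand is continuous, so the integrated equation can be
  differentiated and the classical uniqueness result \<open>ode_unique\<close> applies.\<close>

lemma solves_zero_imp_hom_sol:
  assumes s: "solves G \<xi> z (\<lambda>_ _. 0) f F"
  shows "f = hom_sol G \<xi> z (\<chi> h. if snd h then F (fst h) 0 else f (fst h) 0)"
proof (intro ext)
  fix e x
  let ?l = "edge_length G e" and ?w = "edge_w \<xi> z e"
  show "f e x = hom_sol G \<xi> z (\<chi> h. if snd h then F (fst h) 0 else f (fst h) 0) e x"
  proof (cases "x \<in> {0..?l}")
    case True
    have c: "continuous_on {0..?l} (\<lambda>t. ?w * f e t)"
      by (intro continuous_intros solves_continuous[OF s])
    have Fd: "(F e has_vector_derivative ?w * f e t) (at t within {0..?l})" if t: "t \<in> {0..?l}" for t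
    proof (rule has_vector_derivative_transform[OF t])
      show "((\<lambda>x. F e 0 + integral {0..x} (\<lambda>t. ?w * f e t)) has_vector_derivative ?w * f e t) (at t within {0..?l})"
        using has_vector_derivative_add[OF has_vector_derivative_const integral_has_vector_derivative[OF c t]] by simp
      show "F e x = F e 0 + integral {0..x} (\<lambda>t. ?w * f e t)" if "x \<in> {0..?l}" for x
        using solvesD(3)[OF s that] by simp
    qed
    show ?thesis using ode_unique[OF solvesD(2)[OF s] Fd True] True by (simp add: hom_sol_def)
  next
    case False
    then show ?thesis using solvesD(1)[OF s False] by (simp only: hom_sol_def if_False)
  qed
qed

section \<open>The system matrix\<close>

text \<open>Block-diagonal over edges: with C, S taken at the edge length, rows for the near and far
  end and columns for value and derivative at 0, the block is (1 0; C S). The block of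
  \<open>hom_sol_deriv_matrix\<close> is (0 1; -wS -C), its second row negated to point into the
  edge.\<close>

definition hom_sol_value_matrix :: "('v, 'e::finite) metric_graph \<Rightarrow> complex ^ 'e \<Rightarrow> complex \<Rightarrow> 'e end_mat" where
  "hom_sol_value_matrix G \<xi> z = (\<chi> h k. if fst k = fst h then
     (if snd h then (if snd k then ode_sin (edge_w \<xi> z (fst h)) (edge_length G (fst h))
                     else ode_cos (edge_w \<xi> z (fst h)) (edge_length G (fst h)))
      else (if snd k then 0 else 1)) else 0)"

definition hom_sol_deriv_matrix :: "('v, 'e::finite) metric_graph \<Rightarrow> complex ^ 'e \<Rightarrow> complex \<Rightarrow> 'e end_mat" where
  "hom_sol_deriv_matrix G \<xi> z = (\<chi> h k. if fst k = fst h then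
     (if snd h then (if snd k then - ode_cos (edge_w \<xi> z (fst h)) (edge_length G (fst h))
                     else - (edge_w \<xi> z (fst h) * ode_sin (edge_w \<xi> z (fst h)) (edge_length G (fst h))))
      else (if snd k then 1 else 0)) else 0)"

lemma sum_edge_ends:
  fixes \<phi> :: "bool \<Rightarrow> complex" and c :: "'e::finite end_vec"
  shows "(\<Sum>k\<in>UNIV. (if fst k = e then \<phi> (snd k) else 0) * c $ k) = \<phi> False * c $ (e, False) + \<phi> True * c $ (e, True)"
proof -
  have "(\<Sum>k\<in>UNIV. (if fst k = e then \<phi> (snd k) else 0) * c $ k) =
      (\<Sum>k\<in>{(e, False), (e, True)}. (if fst k = e then \<phi> (snd k) else 0) * c $ k)"
    by (rule sum.mono_neutral_right) auto
  then show ?thesis by simp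
qed

lemma end_values_hom_sol:
  fixes G :: "('v, 'e::finite) metric_graph"
  assumes l: "\<And>e. 0 < edge_length G e"
  shows "end_values G (hom_sol G \<xi> z c) = hom_sol_value_matrix G \<xi> z *v c"
proof (subst vec_eq_iff, rule allI)
  fix h :: "'e edge_end"
  obtain e b where h: "h = (e, b)" by (cases h)
  let ?C = "ode_cos (edge_w \<xi> z e) (edge_length G e)" and ?S = "ode_sin (edge_w \<xi> z e) (edge_length G e)"
  let ?\<phi> = "\<lambda>s. if b then (if s then ?S else ?C) else (if s then 0 else 1)"
  have "(hom_sol_value_matrix G \<xi> z *v c) $ h =
      (\<Sum>k\<in>UNIV. (if fst k = e then ?\<phi> (snd k) else 0) * c $ k)"
    by (simp add: matrix_vector_mult_def hom_sol_value_matrix_def h cong: if_cong)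
  also have "\<dots> = end_values G (hom_sol G \<xi> z c) $ h"
    unfolding sum_edge_ends[of e ?\<phi> c] using l[of e] by (simp add: end_values_def hom_sol_def h)
  finally show "end_values G (hom_sol G \<xi> z c) $ h = (hom_sol_value_matrix G \<xi> z *v c) $ h" ..
qed

lemma end_derivs_hom_sol:
  fixes G :: "('v, 'e::finite) metric_graph"
  shows "end_derivs G (hom_sol_deriv \<xi> z c) = hom_sol_deriv_matrix G \<xi> z *v c"
proof (subst vec_eq_iff, rule allI)
  fix h :: "'e edge_end"
  obtain e b where h: "h = (e, b)" by (cases h)
  let ?w = "edge_w \<xi> z e"
  let ?C = "ode_cos ?w (edge_length G e)" and ?S = "ode_sin ?w (edge_length G e)"
  let ?\<phi> = "\<lambda>s. if b then (if s then - ?C else - (?w * ?S)) else (if s then 1 else 0)"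
  have "(hom_sol_deriv_matrix G \<xi> z *v c) $ h =
      (\<Sum>k\<in>UNIV. (if fst k = e then ?\<phi> (snd k) else 0) * c $ k)"
    by (simp add: matrix_vector_mult_def hom_sol_deriv_matrix_def h cong: if_cong)
  also have "\<dots> = end_derivs G (hom_sol_deriv \<xi> z c) $ h"
    unfolding sum_edge_ends[of e ?\<phi> c] by (simp add: end_derivs_def hom_sol_deriv_def h)
  finally show "end_derivs G (hom_sol_deriv \<xi> z c) $ h = (hom_sol_deriv_matrix G \<xi> z *v c) $ h" ..
qed

text \<open>Maps Cauchy data to the defects in the vertex conditions, factored through end values
  and end derivatives; the parameters are kept as one tuple because analyticity is stated on
  tuples.\<close>

definition system_matrix :: "('v::finite, 'e::finite) metric_graph \<Rightarrow> ('v, 'e) param \<Rightarrow> 'e end_mat" where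
  "system_matrix G p = value_matrix G (fst p) ** hom_sol_value_matrix G (fst (snd (snd p))) (snd (snd (snd p))) +
     deriv_matrix G (fst (snd p)) (fst (snd (snd p))) ** hom_sol_deriv_matrix G (fst (snd (snd p))) (snd (snd (snd p)))"

lemma system_matrix_mult:
  assumes l: "\<And>e. 0 < edge_length G e"
  shows "system_matrix G (A, B, \<xi>, z) *v c =
    value_matrix G A *v end_values G (hom_sol G \<xi> z c) + deriv_matrix G B \<xi> *v end_derivs G (hom_sol_deriv \<xi> z c)"
  by (simp add: system_matrix_def end_values_hom_sol[OF l] end_derivs_hom_sol matrix_vector_mult_add_rdistrib matrix_vector_mul_assoc)

lemma zero_in_L2: "(\<lambda>_ _. 0) \<in> L2 G"
  by (simp add: L2_def L2_interval_def)

lemma hom_sol_in_H_dom_iff: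
  assumes sup: "supported G A" "supported G B"
    and l: "\<And>e. 0 < edge_length G e" and \<xi>: "\<And>e. \<xi> $ e \<noteq> 0"
  shows "hom_sol G \<xi> z c \<in> H_dom G A B \<xi> \<longleftrightarrow> system_matrix G (A, B, \<xi>, z) *v c = 0"
  unfolding system_matrix_mult[OF l]
  by (rule H_dom_iff[OF sup hom_sol_solves solves_H2_graph(1)[OF hom_sol_solves zero_in_L2 l \<xi>] l])

text \<open>Value and derivative at coordinate 0 return the Cauchy data; positive length makes the
  derivative within the edge unique.\<close>

lemma hom_sol_inject:
  fixes G :: "('v, 'e::finite) metric_graph"
  assumes l: "\<And>e. 0 < edge_length G e" and eq: "hom_sol G \<xi> z c = hom_sol G \<xi> z d"
  shows "c = d"
proof (subst vec_eq_iff, rule allI)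
  fix h :: "'e edge_end"
  obtain e b where h: "h = (e, b)" by (cases h)
  have v: "end_value G (hom_sol G \<xi> z c) (e, False) = c $ (e, False)" for c
    using l[of e] by (simp add: hom_sol_def)
  have d: "end_deriv G (hom_sol G \<xi> z c) (e, False) = c $ (e, True)" for c
    unfolding end_deriv_eq[OF hom_sol_solves l] by (simp add: end_derivs_def hom_sol_deriv_def)
  show "c $ h = d $ h"
    using v[of c] v[of d] d[of c] d[of d] eq h by (cases b) simp_all
qed

lemma H_kernel_eq:
  assumes sup: "supported G A" "supported G B"
    and l: "\<And>e. 0 < edge_length G e" and \<xi>: "\<And>e. \<xi> $ e \<noteq> 0"
  shows "H_kernel G A B \<xi> z = hom_sol G \<xi> z ` {c. system_matrix G (A, B, \<xi>, z) *v c = 0}"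
proof (intro set_eqI iffI)
  fix f assume f: "f \<in> H_kernel G A B \<xi> z"
  then have dom: "f \<in> H_dom G A B \<xi>" and eq: "L2_eq G (H_minus G \<xi> z f) (\<lambda>_ _. 0)" by (auto simp: H_kernel_def)
  have "f \<in> H2_graph G" using dom by (simp add: H_dom_def)
  then obtain F where "solves G \<xi> z (\<lambda>_ _. 0) f F"
    by (rule H2_graph_solves[OF _ eq zero_in_L2 l \<xi>])
  then obtain c where "f = hom_sol G \<xi> z c" using solves_zero_imp_hom_sol by blast
  then show "f \<in> hom_sol G \<xi> z ` {c. system_matrix G (A, B, \<xi>, z) *v c = 0}"
    using dom hom_sol_in_H_dom_iff[OF sup l \<xi>] by auto
next
  fix f assume "f \<in> hom_sol G \<xi> z ` {c. system_matrix G (A, B, \<xi>, z) *v c = 0}"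
  then obtain c where "f = hom_sol G \<xi> z c" "system_matrix G (A, B, \<xi>, z) *v c = 0" by blast
  then show "f \<in> H_kernel G A B \<xi> z"
    using hom_sol_in_H_dom_iff[OF sup l \<xi>] solves_H2_graph(2)[OF hom_sol_solves zero_in_L2 l \<xi>]
    by (simp add: H_kernel_def)
qed

lemma dim_H_kernel:
  fixes G :: "('v::finite, 'e::finite) metric_graph"
  assumes sup: "supported G A" "supported G B"
    and l: "\<And>e. 0 < edge_length G e" and \<xi>: "\<And>e. \<xi> $ e \<noteq> 0"
  shows "edge_fun.dim (H_kernel G A B \<xi> z) = vec.dim {c. system_matrix G (A, B, \<xi>, z) *v c = 0}"
proof -
  \<comment> \<open>Only the space of Cauchy data is finite-dimensional; the functions on the graph
    are not, so the asymmetric locale is needed.\<close>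
  interpret P: finite_dimensional_vector_space_pair_1 "(*s)" "cart_basis :: 'e end_vec set"
    "\<lambda>(c::complex) (f::'e \<Rightarrow> real \<Rightarrow> complex). (\<lambda>e x. c * f e x)" ..
  have lin: "Vector_Spaces.linear (*s) (\<lambda>(c::complex) (f::'e \<Rightarrow> real \<Rightarrow> complex). (\<lambda>e x. c * f e x)) (hom_sol G \<xi> z)"
    by (rule Vector_Spaces.linear_iff[THEN iffD2])
       (auto simp: hom_sol_def fun_eq_iff algebra_simps vec.vector_space_axioms edge_fun.vector_space_axioms)
  show ?thesis
    unfolding H_kernel_eq[OF sup l \<xi>]
    by (rule P.dim_image_eq[OF lin]) (auto intro!: inj_onI hom_sol_inject[OF l])
qed

section \<open>Bounded invertibility and the determinant\<close>

text \<open>For g = 0 the last conjunct of \<open>has_bounded_inverse\<close> makes every kernel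
  element equal to \<open>R 0\<close>, but a singular matrix yields a non-zero kernel element
  besides 0.\<close>

lemma singular_imp_no_inverse:
  fixes G :: "('v::finite, 'e::finite) metric_graph"
  assumes sup: "supported G A" "supported G B"
    and l: "\<And>e. 0 < edge_length G e" and \<xi>: "\<And>e. \<xi> $ e \<noteq> 0"
    and det: "det (system_matrix G (A, B, \<xi>, z)) = 0"
  shows "\<not> has_bounded_inverse G (H_dom G A B \<xi>) (H_minus G \<xi> z)"
proof
  assume "has_bounded_inverse G (H_dom G A B \<xi>) (H_minus G \<xi> z)"
  then obtain R :: "('e \<Rightarrow> real \<Rightarrow> complex) \<Rightarrow> 'e \<Rightarrow> real \<Rightarrow> complex"
    where R: "\<And>f. f \<in> H_dom G A B \<xi> \<Longrightarrow> L2_eq G (H_minus G \<xi> z f) (\<lambda>_ _. 0) \<Longrightarrow> R (\<lambda>_ _. 0) = f"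
    unfolding has_bounded_inverse_def using zero_in_L2 by blast
  obtain c where c: "system_matrix G (A, B, \<xi>, z) *v c = 0" "c \<noteq> 0"
    using det ker_matrix_iff_det_nz by blast
  have "R (\<lambda>_ _. 0) = hom_sol G \<xi> z d" if "system_matrix G (A, B, \<xi>, z) *v d = 0" for d
    using R hom_sol_in_H_dom_iff[OF sup l \<xi>] solves_H2_graph(2)[OF hom_sol_solves zero_in_L2 l \<xi>] that by blast
  from this[OF c(1)] this[of 0] have "hom_sol G \<xi> z c = hom_sol G \<xi> z 0" by simp
  then show False using hom_sol_inject[OF l] c(2) by blast
qed

lemma norm_vec_le_bound:
  fixes v :: "complex ^ 'n" and b :: real
  assumes "\<And>i. norm (v $ i) \<le> b"
  shows "norm v \<le> CARD('n) * b"
proof -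
  have "norm v \<le> (\<Sum>i\<in>UNIV. norm (v $ i))" unfolding norm_vec_def by (rule L2_set_le_sum) simp
  also have "\<dots> \<le> (\<Sum>i\<in>(UNIV :: 'n set). b)" by (intro sum_mono assms)
  finally show ?thesis by simp
qed

lemma particular_solution:
  fixes G :: "('v, 'e::finite) metric_graph"
  assumes l: "\<And>e. 0 < edge_length G e"
  shows "\<exists>K\<ge>0. \<forall>g\<in>L2 G. \<exists>u U. solves G \<xi> z g u U \<and>
    (\<forall>e. \<forall>x\<in>{0..edge_length G e}. norm (u e x) \<le> K * L2_norm G g \<and> norm (U e x) \<le> K * L2_norm G g)"
proof -
  define Sol where "Sol = (\<lambda>e K h u u1. u1 0 = 0 \<and>
    (\<forall>x\<in>{0..edge_length G e}. (u has_vector_derivative u1 x) (at x within {0..edge_length G e}) \<and>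
       u1 x = integral {0..x} (\<lambda>t. edge_w \<xi> z e * u t + h t) \<and>
       norm (u x) \<le> K * (LINT t|lebesgue_on {0..edge_length G e}. norm (h t)) \<and>
       norm (u1 x) \<le> K * (LINT t|lebesgue_on {0..edge_length G e}. norm (h t))))"
  have "\<exists>K\<ge>0. \<forall>h. integrable (lebesgue_on {0..edge_length G e}) h \<longrightarrow> (\<exists>u u1. Sol e K h u u1)" for e
    unfolding Sol_def by (rule ode_particular[OF less_imp_le[OF l]])
  then obtain K where K: "\<And>e. K e \<ge> 0"
    "\<And>e h. integrable (lebesgue_on {0..edge_length G e}) h \<Longrightarrow> \<exists>u u1. Sol e (K e) h u u1"
    by metis
  \<comment> \<open>The constant of the edge equation, times |\<xi>|^2 from the source -\<xi>^2 g
    and the root of the length from Cauchy-Schwarz.\<close>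
  let ?k = "\<lambda>e. K e * ((norm (\<xi> $ e))\<^sup>2 * sqrt (edge_length G e))"
  have k0: "0 \<le> ?k e" for e using K(1)[of e] l[of e] by (simp add: less_imp_le)
  define K' where "K' = (\<Sum>e\<in>UNIV. ?k e)"
  have kK: "?k e \<le> K'" for e unfolding K'_def by (rule member_le_sum) (use k0 in auto)
  have "0 \<le> K'" unfolding K'_def by (intro sum_nonneg k0)
  moreover have "\<exists>u U. solves G \<xi> z g u U \<and>
    (\<forall>e. \<forall>x\<in>{0..edge_length G e}. norm (u e x) \<le> K' * L2_norm G g \<and> norm (U e x) \<le> K' * L2_norm G g)"
    if g: "g \<in> L2 G" for g
  proof -
    define h where "h = (\<lambda>e x. - (\<xi> $ e)\<^sup>2 * g e x)"
    have gi: "integrable (lebesgue_on {0..edge_length G e}) (g e)" for e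
      using g L2_interval_integrable by (auto simp: L2_def)
    then have hi: "integrable (lebesgue_on {0..edge_length G e}) (h e)" for e
      unfolding h_def by (rule integrable_mult_right)
    have N: "0 \<le> L2_norm G g" unfolding L2_norm_def by (intro real_sqrt_ge_zero sum_nonneg) simp
    have hb: "K e * (LINT t|lebesgue_on {0..edge_length G e}. norm (h e t)) \<le> K' * L2_norm G g" for e
    proof -
      have "(LINT t|lebesgue_on {0..edge_length G e}. norm (h e t)) =
          (norm (\<xi> $ e))\<^sup>2 * (LINT t|lebesgue_on {0..edge_length G e}. norm (g e t))"
        by (simp add: h_def norm_mult norm_power)
      also have "\<dots> \<le> (norm (\<xi> $ e))\<^sup>2 * (sqrt (edge_length G e) * L2_norm G g)"
        by (intro mult_left_mono LINT_norm_le_L2_norm g l) simp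
      finally have "K e * (LINT t|lebesgue_on {0..edge_length G e}. norm (h e t)) \<le>
          K e * ((norm (\<xi> $ e))\<^sup>2 * (sqrt (edge_length G e) * L2_norm G g))"
        using K(1) by (rule mult_left_mono)
      also have "\<dots> = ?k e * L2_norm G g" by simp
      also have "\<dots> \<le> K' * L2_norm G g" using kK N by (rule mult_right_mono)
      finally show ?thesis .
    qed
    obtain v U where vU: "\<And>e. Sol e (K e) (h e) (v e) (U e)"
      using K(2)[OF hi] by metis
    have U0: "U e 0 = 0" for e using vU[of e] unfolding Sol_def by blast
    have v: "(v e has_vector_derivative U e x) (at x within {0..edge_length G e})"
      "U e x = integral {0..x} (\<lambda>t. edge_w \<xi> z e * v e t + h e t)"
      "norm (v e x) \<le> K e * (LINT t|lebesgue_on {0..edge_length G e}. norm (h e t))"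
      "norm (U e x) \<le> K e * (LINT t|lebesgue_on {0..edge_length G e}. norm (h e t))"
      if "x \<in> {0..edge_length G e}" for e x
      using vU[of e] that unfolding Sol_def by blast+
    \<comment> \<open>\<open>solves\<close> demands the value 0 off the edge, which the edgewise
      solution need not have.\<close>
    define u where "u = (\<lambda>e x. if x \<in> {0..edge_length G e} then v e x else 0)"
    have "solves G \<xi> z g u U"
      unfolding solves_def
    proof (intro allI conjI impI ballI)
      fix e x
      show "u e x = 0" if "x \<notin> {0..edge_length G e}" using that by (simp only: u_def if_False)
      assume x: "x \<in> {0..edge_length G e}"
      from v(1)[OF x] show "(u e has_vector_derivative U e x) (at x within {0..edge_length G e})"
        by (rule has_vector_derivative_transform[OF x, rotated]) (simp add: u_def)
      have "U e x = integral {0..x} (\<lambda>t. edge_w \<xi> z e * v e t + h e t)" by (rule v(2)[OF x])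
      also have "\<dots> = integral {0..x} (\<lambda>t. edge_w \<xi> z e * u e t - (\<xi> $ e)\<^sup>2 * g e t)"
        using x by (intro Henstock_Kurzweil_Integration.integral_cong) (auto simp: u_def h_def)
      finally show "U e x = U e 0 + integral {0..x} (\<lambda>t. edge_w \<xi> z e * u e t - (\<xi> $ e)\<^sup>2 * g e t)"
        using U0 by simp
    qed
    moreover have "norm (u e x) \<le> K' * L2_norm G g \<and> norm (U e x) \<le> K' * L2_norm G g"
      if x: "x \<in> {0..edge_length G e}" for e x
      using order_trans[OF v(3)[OF x] hb] order_trans[OF v(4)[OF x] hb] x by (simp add: u_def)
    ultimately show ?thesis by blast
  qed
  ultimately show ?thesis by blast
qed

lemma hom_sol_bound:
  fixes G :: "('v, 'e::finite) metric_graph"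
  shows "\<exists>K\<ge>0. \<forall>c e x. norm (hom_sol G \<xi> z c e x) \<le> K * norm c"
proof -
  have "\<exists>B\<ge>0. \<forall>x\<in>{0..edge_length G e}. norm (ode_cos (edge_w \<xi> z e) x) + norm (ode_sin (edge_w \<xi> z e) x) \<le> B" for e
  proof -
    have "bounded ((\<lambda>x. norm (ode_cos (edge_w \<xi> z e) x) + norm (ode_sin (edge_w \<xi> z e) x)) ` {0..edge_length G e})"
      by (intro compact_imp_bounded compact_continuous_image continuous_intros compact_Icc)
    then obtain a where a: "\<And>x. x \<in> {0..edge_length G e} \<Longrightarrow>
        \<bar>norm (ode_cos (edge_w \<xi> z e) x) + norm (ode_sin (edge_w \<xi> z e) x)\<bar> \<le> a"
      unfolding bounded_iff real_norm_def by blast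
    have "norm (ode_cos (edge_w \<xi> z e) x) + norm (ode_sin (edge_w \<xi> z e) x) \<le> \<bar>a\<bar>"
      if "x \<in> {0..edge_length G e}" for x
      by (rule order_trans[OF order_trans[OF abs_ge_self a[OF that]] abs_ge_self])
    then show ?thesis by (intro exI[of _ "\<bar>a\<bar>"] conjI ballI abs_ge_zero)
  qed
  then obtain B where B: "\<And>e. 0 \<le> B e"
    "\<And>e x. x \<in> {0..edge_length G e} \<Longrightarrow> norm (ode_cos (edge_w \<xi> z e) x) + norm (ode_sin (edge_w \<xi> z e) x) \<le> B e" by metis
  have BB: "B e \<le> (\<Sum>e\<in>UNIV. B e)" for e by (rule member_le_sum) (use B in auto)
  have S0: "0 \<le> (\<Sum>e\<in>UNIV. B e)" by (intro sum_nonneg B)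
  have "norm (hom_sol G \<xi> z c e x) \<le> (\<Sum>e\<in>UNIV. B e) * norm c" for c e x
  proof (cases "x \<in> {0..edge_length G e}")
    case True
    let ?C = "ode_cos (edge_w \<xi> z e) x" and ?S = "ode_sin (edge_w \<xi> z e) x"
    have "norm (hom_sol G \<xi> z c e x) = norm (c $ (e, False) * ?C + c $ (e, True) * ?S)"
      using True by (simp add: hom_sol_def)
    also have "\<dots> \<le> norm (c $ (e, False)) * norm ?C + norm (c $ (e, True)) * norm ?S"
      by (metis norm_mult norm_triangle_ineq)
    also have "\<dots> \<le> norm c * norm ?C + norm c * norm ?S"
      by (intro add_mono mult_right_mono Finite_Cartesian_Product.norm_nth_le) auto
    also have "\<dots> = norm c * (norm ?C + norm ?S)" by (simp add: distrib_left)
    also have "\<dots> \<le> norm c * (\<Sum>e\<in>UNIV. B e)"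
      using B(2)[OF True] BB[of e] by (intro mult_left_mono) auto
    finally show ?thesis by (simp add: mult.commute)
  next
    case False
    then have "hom_sol G \<xi> z c e x = 0" by (simp only: hom_sol_def if_False)
    then show ?thesis using S0 by simp
  qed
  then show ?thesis using S0 by blast
qed

lemma H2_graph_subset_L2: "H2_graph G \<subseteq> L2 G"
  by (auto simp: H2_graph_def H2_interval_def L2_def)

text \<open>A particular solution violates the vertex conditions by some \<open>r\<close>; the
  homogeneous solution with Cauchy data -M^{-1} r repairs this without changing the equation. The
  bound follows since every map involved is bounded.\<close>

lemma nonsingular_imp_inverse:
  fixes G :: "('v::finite, 'e::finite) metric_graph"
  assumes sup: "supported G A" "supported G B"
    and l: "\<And>e. 0 < edge_length G e" and \<xi>: "\<And>e. \<xi> $ e \<noteq> 0"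
    and det: "det (system_matrix G (A, B, \<xi>, z)) \<noteq> 0"
  shows "has_bounded_inverse G (H_dom G A B \<xi>) (H_minus G \<xi> z)"
proof -
  let ?D = "H_dom G A B \<xi>" and ?T = "H_minus G \<xi> z" and ?M = "system_matrix G (A, B, \<xi>, z)"
  let ?P = "value_matrix G A" and ?Q = "deriv_matrix G B \<xi>"
  obtain K where K: "0 \<le> K" "\<And>g. g \<in> L2 G \<Longrightarrow> \<exists>u U. solves G \<xi> z g u U \<and>
    (\<forall>e. \<forall>x\<in>{0..edge_length G e}. norm (u e x) \<le> K * L2_norm G g \<and> norm (U e x) \<le> K * L2_norm G g)"
    using particular_solution[OF l, of \<xi> z] by blast
  obtain S where S: "0 \<le> S" "\<And>c e x. norm (hom_sol G \<xi> z c e x) \<le> S * norm c"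
    using hom_sol_bound[of G \<xi> z] by blast
  obtain N where N: "?M ** N = mat 1"
    using det by (auto simp: invertible_det_nz[symmetric] invertible_right_inverse)
  obtain kN where kN: "0 < kN" "\<And>x. norm (N *v x) \<le> norm x * kN"
    using bounded_linear.pos_bounded[OF matrix_vector_mul_bounded_linear[of N]] by blast
  obtain kP where kP: "0 < kP" "\<And>x. norm (?P *v x) \<le> norm x * kP"
    using bounded_linear.pos_bounded[OF matrix_vector_mul_bounded_linear[of ?P]] by blast
  obtain kQ where kQ: "0 < kQ" "\<And>x. norm (?Q *v x) \<le> norm x * kQ"
    using bounded_linear.pos_bounded[OF matrix_vector_mul_bounded_linear[of ?Q]] by blast
  let ?n = "real CARD('e edge_end)"
  \<comment> \<open>\<open>K\<close> bounds the particular solution. The product traces the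
    correction: end data, of norm at most \<open>?n * K\<close>, give \<open>r\<close> through
    \<open>kP\<close> and \<open>kQ\<close>, then \<open>c\<close> through \<open>kN\<close>, then
    the homogeneous solution through \<open>S\<close>.\<close>
  define b where "b = K + S * (?n * K * (kP + kQ) * kN)"
  have b0: "0 \<le> b" using K(1) S(1) kN(1) kP(1) kQ(1) by (simp add: b_def)
  define C where "C = sqrt (\<Sum>e\<in>UNIV. edge_length G e) * b"
  have ex: "\<exists>f\<in>?D. L2_eq G (?T f) g \<and> L2_norm G f \<le> C * L2_norm G g" if g: "g \<in> L2 G" for g
  proof -
    have n0: "0 \<le> L2_norm G g" unfolding L2_norm_def by (intro real_sqrt_ge_zero sum_nonneg) simp
    obtain u U where u: "solves G \<xi> z g u U"
      "\<And>e x. x \<in> {0..edge_length G e} \<Longrightarrow> norm (u e x) \<le> K * L2_norm G g \<and> norm (U e x) \<le> K * L2_norm G g"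
      using K(2)[OF g] by blast
    define r where "r = ?P *v end_values G u + ?Q *v end_derivs G U"
    define c where "c = - (N *v r)"
    \<comment> \<open>The factor 1 matches the shape of \<open>solves_combine\<close>.\<close>
    define f where "f = (\<lambda>e x. u e x + 1 * hom_sol G \<xi> z c e x)"
    define F where "F = (\<lambda>e x. U e x + 1 * hom_sol_deriv \<xi> z c e x)"
    have "solves G \<xi> z (\<lambda>e x. g e x + 1 * 0) f F"
      unfolding f_def F_def by (rule solves_combine[OF u(1) hom_sol_solves g zero_in_L2])
    then have s: "solves G \<xi> z g f F" by simp
    note f2 = solves_H2_graph[OF s g l \<xi>]
    have ev: "end_values G f = end_values G u + end_values G (hom_sol G \<xi> z c)"
      "end_derivs G F = end_derivs G U + end_derivs G (hom_sol_deriv \<xi> z c)"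
      by (auto simp: end_values_def end_derivs_def f_def F_def vec_eq_iff)
    have "?P *v end_values G f + ?Q *v end_derivs G F = r + ?M *v c"
      by (simp add: ev r_def system_matrix_mult[OF l] matrix_vector_right_distrib)
    also have "?M *v c = - ((?M ** N) *v r)"
      using matrix_vector_mult_diff_distrib[of ?M 0 "N *v r"] by (simp add: c_def matrix_vector_mul_assoc)
    also have "r + - ((?M ** N) *v r) = 0" by (simp add: N)
    finally have D: "f \<in> ?D" using H_dom_iff[OF sup s f2(1) l] by simp
    have ends: "norm (end_values G u $ h) \<le> K * L2_norm G g" "norm (end_derivs G U $ h) \<le> K * L2_norm G g" for h
      using u(2)[of 0 "fst h"] u(2)[of "edge_length G (fst h)" "fst h"] l[of "fst h"]
      by (auto simp: end_values_def end_derivs_def)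
    have ne: "norm (end_values G u) \<le> ?n * (K * L2_norm G g)" "norm (end_derivs G U) \<le> ?n * (K * L2_norm G g)"
      by (rule norm_vec_le_bound, rule ends)+
    have "norm r \<le> norm (end_values G u) * kP + norm (end_derivs G U) * kQ"
      unfolding r_def by (intro norm_triangle_mono kP(2) kQ(2))
    also have "\<dots> \<le> ?n * (K * L2_norm G g) * kP + ?n * (K * L2_norm G g) * kQ"
      using kP(1) kQ(1) by (intro add_mono mult_right_mono ne) auto
    finally have nr: "norm r \<le> ?n * (K * L2_norm G g) * kP + ?n * (K * L2_norm G g) * kQ" .
    have "norm c \<le> norm r * kN" unfolding c_def using kN(2)[of r] by simp
    also have "\<dots> \<le> (?n * (K * L2_norm G g) * kP + ?n * (K * L2_norm G g) * kQ) * kN"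
      using kN(1) by (intro mult_right_mono nr) auto
    finally have nc: "norm c \<le> (?n * (K * L2_norm G g) * kP + ?n * (K * L2_norm G g) * kQ) * kN" .
    have "norm (f e x) \<le> b * L2_norm G g" if x: "x \<in> {0..edge_length G e}" for e x
    proof -
      have "norm (f e x) \<le> norm (u e x) + norm (hom_sol G \<xi> z c e x)"
        unfolding f_def by (simp add: norm_triangle_ineq)
      also have "\<dots> \<le> K * L2_norm G g + S * ((?n * (K * L2_norm G g) * kP + ?n * (K * L2_norm G g) * kQ) * kN)"
        using u(2)[OF x] order_trans[OF S(2) mult_left_mono[OF nc S(1)]] by (intro add_mono) auto
      also have "\<dots> = b * L2_norm G g" by (simp add: b_def algebra_simps)
      finally show ?thesis .
    qed
    then have "L2_norm G f \<le> sqrt (\<Sum>e\<in>UNIV. edge_length G e) * (b * L2_norm G g)"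
      using f2(1) H2_graph_subset_L2 l b0 n0 by (intro L2_norm_le_bound) auto
    then show ?thesis using D f2(2) by (auto simp: C_def mult.assoc)
  qed
  \<comment> \<open>The difference of two solutions is homogeneous and satisfies the vertex
    conditions, so its Cauchy data lie in the trivial kernel of the matrix. This also makes the
    chosen \<open>R\<close> independent of representatives.\<close>
  have uniq: "f = f'" if f: "f \<in> ?D" "L2_eq G (?T f) g" and f': "f' \<in> ?D" "L2_eq G (?T f') g" and g: "g \<in> L2 G" for f f' g
  proof -
    have fH: "f \<in> H2_graph G" "f' \<in> H2_graph G" using f f' by (auto simp: H_dom_def)
    obtain F where F: "solves G \<xi> z g f F" by (rule H2_graph_solves[OF fH(1) f(2) g l \<xi>])
    obtain F' where F': "solves G \<xi> z g f' F'" by (rule H2_graph_solves[OF fH(2) f'(2) g l \<xi>])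
    let ?d = "\<lambda>e x. f e x + (-1) * f' e x" and ?dF = "\<lambda>e x. F e x + (-1) * F' e x"
    have "solves G \<xi> z (\<lambda>e x. g e x + (-1) * g e x) ?d ?dF"
      by (rule solves_combine[OF F F' g g])
    then have s: "solves G \<xi> z (\<lambda>_ _. 0) ?d ?dF" by simp
    have d: "end_values G ?d = end_values G f - end_values G f'" "end_derivs G ?dF = end_derivs G F - end_derivs G F'"
      by (auto simp: end_values_def end_derivs_def vec_eq_iff)
    have "?P *v end_values G f + ?Q *v end_derivs G F = 0" "?P *v end_values G f' + ?Q *v end_derivs G F' = 0"
      using H_dom_iff[OF sup F fH(1) l] H_dom_iff[OF sup F' fH(2) l] f f' by auto
    moreover have "?P *v end_values G ?d + ?Q *v end_derivs G ?dF =
        (?P *v end_values G f + ?Q *v end_derivs G F) - (?P *v end_values G f' + ?Q *v end_derivs G F')"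
      unfolding d matrix_vector_mult_diff_distrib by (rule add_diff_add[symmetric])
    ultimately have "?P *v end_values G ?d + ?Q *v end_derivs G ?dF = 0" by simp
    then have "?d \<in> ?D"
      using H_dom_iff[OF sup s solves_H2_graph(1)[OF s zero_in_L2 l \<xi>] l] by blast
    moreover obtain c where c: "?d = hom_sol G \<xi> z c" using solves_zero_imp_hom_sol[OF s] by blast
    ultimately have "?M *v c = 0" using hom_sol_in_H_dom_iff[OF sup l \<xi>] by simp
    then have "c = 0" using det ker_matrix_iff_det_nz by blast
    then have "?d e x = 0" for e x using fun_cong[OF fun_cong[OF c, of e], of x] by (simp add: hom_sol_def)
    then show ?thesis by (auto simp: fun_eq_iff)
  qed
  define R where "R = (\<lambda>g. SOME f. f \<in> ?D \<and> L2_eq G (?T f) g \<and> L2_norm G f \<le> C * L2_norm G g)"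
  have R: "R g \<in> ?D \<and> L2_eq G (?T (R g)) g \<and> L2_norm G (R g) \<le> C * L2_norm G g" if "g \<in> L2 G" for g
  proof -
    have "\<exists>f. f \<in> ?D \<and> L2_eq G (?T f) g \<and> L2_norm G f \<le> C * L2_norm G g" using ex[OF that] by blast
    then show ?thesis unfolding R_def by (rule someI_ex)
  qed
  show ?thesis
    unfolding has_bounded_inverse_def
  proof (intro exI[of _ R] exI[of _ C] ballI conjI impI)
    fix g assume g: "g \<in> L2 G"
    show "R g \<in> ?D" "L2_eq G (?T (R g)) g" "L2_norm G (R g) \<le> C * L2_norm G g" using R[OF g] by blast+
    fix f assume "f \<in> ?D" "L2_eq G (?T f) g"
    then show "R g = f" using uniq R[OF g] g by blast
  qed
qed

section \<open>Analyticity and non-triviality of the determinant\<close>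

lemma analytic_fun_edge_w: "analytic_fun M (\<lambda>p. edge_w (fst (snd (snd p))) (snd (snd (snd p))) e)"
proof -
  have "analytic_fun M (\<lambda>p. (-1) * snd (snd (snd p)) * (fst (snd (snd p)) $ e * fst (snd (snd p)) $ e))"
    by (intro analytic_fun_mult analytic_fun_const analytic_fun_coords)
  then show ?thesis by (simp add: edge_w_def power2_eq_square)
qed

lemma analytic_fun_system_matrix: "analytic_fun M (\<lambda>p. system_matrix G p $ i $ j)"
proof -
  note C = analytic_fun_compose[OF analytic_fun_edge_w ode_entire(1)]
    and S = analytic_fun_compose[OF analytic_fun_edge_w ode_entire(2)]
  have mC: "analytic_fun M (\<lambda>p. - ode_cos (edge_w (fst (snd (snd p))) (snd (snd (snd p))) e) x)" for e x
    using analytic_fun_mult[OF analytic_fun_const[of M "-1"] C[of M e x]] by simp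
  have mS: "analytic_fun M (\<lambda>p. - (edge_w (fst (snd (snd p))) (snd (snd (snd p))) e *
      ode_sin (edge_w (fst (snd (snd p))) (snd (snd (snd p))) e) x))" for e x
    using analytic_fun_mult[OF analytic_fun_const[of M "-1"] analytic_fun_mult[OF analytic_fun_edge_w[of M e] S[of M e x]]] by simp
  have V: "analytic_fun M (\<lambda>p. hom_sol_value_matrix G (fst (snd (snd p))) (snd (snd (snd p))) $ h $ k)" for h k
    by (cases "fst k = fst h"; cases "snd h"; cases "snd k") (simp_all add: hom_sol_value_matrix_def C S analytic_fun_const)
  have W: "analytic_fun M (\<lambda>p. hom_sol_deriv_matrix G (fst (snd (snd p))) (snd (snd (snd p))) $ h $ k)" for h k
    by (cases "fst k = fst h"; cases "snd h"; cases "snd k") (simp_all add: hom_sol_deriv_matrix_def mC mS analytic_fun_const)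
  show ?thesis
    unfolding system_matrix_def matrix_matrix_mult_def value_matrix_def deriv_matrix_def vector_add_component vec_lambda_beta
    by (intro analytic_fun_add analytic_fun_sum analytic_fun_mult analytic_fun_coords V W)
qed

lemma analytic_fun_det_replace_columns:
  "analytic_fun M (\<lambda>p. det (replace_columns (system_matrix G p) s))"
proof (rule analytic_fun_det)
  fix i j
  show "analytic_fun M (\<lambda>p. replace_columns (system_matrix G p) s $ i $ j)"
    by (cases "s j") (simp_all add: replace_columns_def analytic_fun_system_matrix analytic_fun_const)
qed

text \<open>The rows indexed by \<open>S\<close> are distinct standard basis vectors and the others
  vanish. This shows that Dirichlet conditions have maximal rank.\<close>

lemma rank_joined_identity:
  fixes S :: "('e::finite) edge_end set"
  shows "rank (joined (\<chi> h h'. if h = h' \<and> h \<in> S then 1 else 0) 0) = card S"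
proof -
  let ?J = "joined (\<chi> h h'. if h = h' \<and> h \<in> S then 1 else (0 :: complex)) 0 :: complex ^ ('e edge_end + 'e edge_end) ^ ('e edge_end)"
  have row: "row h ?J = (if h \<in> S then axis (Inl h) 1 else 0)" for h
  proof (subst vec_eq_iff, rule allI)
    fix c
    show "row h ?J $ c = (if h \<in> S then axis (Inl h) 1 else 0) $ c"
      by (cases c; cases "h \<in> S") (simp_all add: row_def joined_def axis_def)
  qed
  let ?B = "(\<lambda>i. axis i (1::complex)) ` (Inl ` S :: ('e edge_end + 'e edge_end) set)"
  have "vec.dim (rows ?J) = card ?B"
  proof (rule vec.dim_unique)
    show "?B \<subseteq> rows ?J"
    proof (rule subsetI)
      fix x assume "x \<in> ?B"
      then obtain h where "h \<in> S" "x = axis (Inl h) 1" by blast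
      then have "x = row h ?J" using row[of h] by (simp only: if_True)
      then show "x \<in> rows ?J" unfolding rows_def by blast
    qed
    show "rows ?J \<subseteq> vec.span ?B"
    proof (rule subsetI)
      fix x assume "x \<in> rows ?J"
      then obtain h where "x = row h ?J" unfolding rows_def by blast
      then have x: "x = (if h \<in> S then axis (Inl h) 1 else 0)" using row[of h] by (simp only:)
      show "x \<in> vec.span ?B"
      proof (cases "h \<in> S")
        case True
        then have "x \<in> ?B" using x by (simp only: if_True) blast
        then show ?thesis by (rule vec.span_base)
      next
        case False
        then show ?thesis using x vec.span_zero by (simp only: if_False)
      qed
    qed
    show "vec.independent ?B" by (rule vec_dim_axis_image)
  qed simp
  also have "\<dots> = card S" unfolding vec_dim_axis_image(2) by (simp add: card_image)
  finally show ?thesis by (simp add: row_rank_def_gen)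
qed

text \<open>
  Dirichlet conditions at spectral parameter \<open>0\<close>: the only affine functions vanishing at both ends are zero.
\<close>

lemma exists_nonsingular_param:
  fixes G :: "('v::finite, 'e::finite) metric_graph"
  assumes l: "\<And>e. 0 < edge_length G e"
  shows "\<exists>p\<in>param_manifold G. det (system_matrix G p) \<noteq> 0"
proof -
  define A :: "'e end_mat ^ 'v" where "A = (\<chi> v h h'. if h = h' \<and> h \<in> ends_at G v then 1 else 0)"
  define \<xi> :: "complex ^ 'e" where "\<xi> = (\<chi> e. 1)"
  let ?p = "(A, 0, \<xi>, 0) :: ('v, 'e) param"
  have "max_rank G A 0"
    unfolding max_rank_def degree_def by (simp add: A_def rank_joined_identity)
  moreover have "supported G A" "supported G 0"
    by (auto simp: supported_def A_def)
  ultimately have "?p \<in> param_manifold G"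
    by (simp add: param_manifold_def param_space_def \<xi>_def)
  moreover have "det (system_matrix G ?p) \<noteq> 0"
    unfolding ker_matrix_iff_det_nz[symmetric]
  proof (intro allI impI)
    fix c assume c: "system_matrix G ?p *v c = 0"
    have v: "value_matrix G A = mat 1"
      by (auto simp: value_matrix_def A_def mat_def vec_eq_iff ends_at_def)
    have d: "deriv_matrix G 0 \<xi> = 0"
      by (simp add: deriv_matrix_def vec_eq_iff)
    have "end_values G (hom_sol G \<xi> 0 c) = 0"
      using c unfolding system_matrix_mult[OF l] v d by simp
    then have e: "end_values G (hom_sol G \<xi> 0 c) $ h = 0" for h by simp
    \<comment> \<open>At w = 0 the solution is a + b x with (a, b) its Cauchy data: the near end
      gives a = 0, and then the far end gives b = 0 because the length is positive.\<close>
    have "c $ (e, b) = 0" for e b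
      using e[of "(e, False)"] e[of "(e, True)"] l[of e]
      by (cases b) (simp_all add: end_values_def hom_sol_def ode_sin_def edge_w_def)
    then show "c = 0" by (auto simp: vec_eq_iff)
  qed
  ultimately show ?thesis by blast
qed

theorem theorem3p8:
  fixes G :: "('v::finite, 'e::finite) metric_graph"
  assumes "\<forall>e. 0 < edge_length G e"
  shows "(\<exists>\<Phi>. analytic_fun (param_manifold G) \<Phi> \<and>
              (\<exists>p \<in> param_manifold G. \<Phi> p \<noteq> 0) \<and>
              spectral_set G = {p \<in> param_manifold G. \<Phi> p = 0}) \<and>
         (\<forall>k\<ge>1. analytic_subset (param_manifold G) (spectral_set_mult G k))"
proof (intro conjI allI impI)
  have l: "0 < edge_length G e" for e using assms by simp
  have "spectral_set G = {p \<in> param_manifold G. det (system_matrix G p) = 0}"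
  proof -
    have "\<not> has_bounded_inverse G (H_dom G A B \<xi>) (H_minus G \<xi> z) \<longleftrightarrow> det (system_matrix G (A, B, \<xi>, z)) = 0"
      if "(A, B, \<xi>, z) \<in> param_manifold G" for A B \<xi> z
    proof -
      have *: "supported G A" "supported G B" and \<xi>: "\<And>e. \<xi> $ e \<noteq> 0"
        using that by (auto simp: param_manifold_def param_space_def)
      show ?thesis
        using singular_imp_no_inverse[OF * l \<xi>] nonsingular_imp_inverse[OF * l \<xi>] by blast
    qed
    then show ?thesis unfolding spectral_set_def by auto
  qed
  moreover have "analytic_fun (param_manifold G) (\<lambda>p. det (system_matrix G p))"
    by (intro analytic_fun_det analytic_fun_system_matrix)
  ultimately show "\<exists>\<Phi>. analytic_fun (param_manifold G) \<Phi> \<and> (\<exists>p \<in> param_manifold G. \<Phi> p \<noteq> 0) \<and>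
      spectral_set G = {p \<in> param_manifold G. \<Phi> p = 0}"
    using exists_nonsingular_param[of G, OF l] by blast
  fix k :: nat
  \<comment> \<open>One function per replacement pattern; there are finitely many, since the
    edge-ends form a finite type.\<close>
  let ?F = "(\<lambda>s p. det (replace_columns (system_matrix G p) s)) ` {s. card {j. s j \<noteq> None} < k}"
  show "analytic_subset (param_manifold G) (spectral_set_mult G k)"
  proof (rule analytic_subset_zeros)
    show "finite ?F" by simp
    show "analytic_fun (param_manifold G) f" if "f \<in> ?F" for f
      using that analytic_fun_det_replace_columns by blast
    have "k \<le> edge_fun.dim (H_kernel G A B \<xi> z) \<longleftrightarrow> (\<forall>f\<in>?F. f (A, B, \<xi>, z) = 0)"
      if "(A, B, \<xi>, z) \<in> param_manifold G" for A B \<xi> z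
    proof -
      have *: "supported G A" "supported G B" and \<xi>: "\<And>e. \<xi> $ e \<noteq> 0"
        using that by (auto simp: param_manifold_def param_space_def)
      show ?thesis unfolding dim_H_kernel[OF * l \<xi>] kernel_dim_ge_iff by simp
    qed
    then show "spectral_set_mult G k = {p \<in> param_manifold G. \<forall>f\<in>?F. f p = 0}"
      unfolding spectral_set_mult_def by auto
  qed
qed

end
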